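(* Let $U=(u_n)_{n\geq 1}$ be a sequence of positive integers and set $U_n=\sum_{i=1}^n u_i$ for all $n\ge0$. Then \begin{align*} \sum_{\lambda\in \overline{\mathcal{P}}(U)}C(\lambda)q^{|\lambda|}&= \prod_{n\geq 1}\frac{\overline{\mathcal{E}}_{u_n}(c_{\overline{U_{n-1}+1}}q^{U_{n-1}+1},c_{U_{n-1}+1}q^{U_{n-1}+1},\ldots,c_{\overline{U_{n}-1}}q^{U_{n}-1},c_{U_{n}-1}q^{U_{n}-1},c_{\overline{U_{n}}}q^{U_{n}},1)}{(1-c_{U_{n-1}+1}q^{U_{n-1}+1})\cdots(1-c_{U_{n}}q^{U_{n}})},\\ \sum_{\lambda\in \mathcal{P}(U)}C(\lambda)q^{|\lambda|}&= \prod_{n\geq 1}\frac{\mathcal{E}_{u_n}(c_{U_{n-1}+1}q^{U_{n-1}+1},\ldots,c_{U_{n}-1}q^{U_{n}-1})}{(1-c_{U_{n-1}+1}q^{U_{n-1}+1})\cdots(1-c_{U_{n}}q^{U_{n}})},\\ \sum_{\lambda\in \overline{\mathcal{D}}(U)}C(\lambda)q^{|\lambda|}&= \sum_{n\geq 1} \frac{\overline{\mathcal{E}}_{u_n}(c_{\overline{U_{n-1}+1}}q^{U_{n-1}+1},c_{U_{n-1}+1}q^{U_{n-1}+1},\ldots,c_{\overline{U_{n}-1}}q^{U_{n}-1},c_{U_{n}-1}q^{U_{n}-1},0,1)}{(1-c_{U_{n-1}+1}q^{U_{n-1}+1})\cdots(1-c_{U_{n}-1}q^{U_{n}-1})}\\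 &\qquad\cdot \prod_{m=1}^{n-1}\frac{\overline{\mathcal{E}}_{u_m}(c_{\overline{U_{m-1}+1}}q^{U_{m-1}+1},c_{U_{m-1}+1}q^{U_{m-1}+1},\ldots,c_{\overline{U_{m}}}q^{U_{m}},c_{U_{m}}q^{U_{m}})}{(1-c_{U_{m-1}+1}q^{U_{m-1}+1})\cdots(1-c_{U_{m}}q^{U_{m}})}. \end{align*}
   Context: Over-lined integers: $\overline{\mathbb{Z}_{\geq 1}}=\{\overline1,\overline2,\ldots\}$ is a disjoint copy of $\mathbb{Z}_{\ge 1}$; both $i$ and $\overline i$ have size $i$; sums and differences use sizes. Order: $0<\overline1<1<\overline2<2<\cdots$. Let $\mathbb P$ be the set of infinite sequences $\lambda=(\lambda_i)_{i\ge1}$ in $\mathbb{Z}_{\geq 0}\sqcup\overline{\mathbb{Z}_{\geq 1}}$ with finitely many nonzero terms such that each $\overline i$ occurs at most once and, if it occurs, it comes after all occurrences of $i$ (sequences need not be monotone). For $\lambda\in\mathbb P$: $|\lambda|$ is the sum of the sizes of the parts; the conjugate $\tilde\lambda=(\tilde\lambda_i)_{i\ge1}$ is given by: $\tilde\lambda_i$ has size $\#\{j\ge1:\lambda_j\ge\overline i\}$ and is over-lined iff $\overline i$ is a part of $\lambda$. With commuting color indeterminates $c_i,c_{\overline i}$ ($i\ge1$), $C(\lambda)=\prod_{0<\overline i\le M(\lambda)}c_{\tilde\lambda_i}$ where $M(\lambda)=\max_i\lambda_i$ (and $C(\lambda)=1$ for the zero sequence). $\overline{\mathcal P}(U)$ (block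 over-partitions of type $U$): the $\lambda\in\mathbb P$ such that for all $n\ge1$, $\min\{\lambda_{U_{n-1}+1},\ldots,\lambda_{U_n}\}\ge\max\{\lambda_{U_n+1},\ldots,\lambda_{U_{n+1}}\}$. $\mathcal P(U)$ (block partitions): elements of $\overline{\mathcal P}(U)$ with no over-lined parts. $\overline{\mathcal D}(U)$: the $\lambda\in\overline{\mathcal P}(U)$ such that for all $n\ge1$, $\min\{\lambda_{U_{n-1}+1},\ldots,\lambda_{U_n}\}-\max\{\lambda_{U_n+1},\ldots,\lambda_{U_{n+1}}\}>0$ (difference of sizes) whenever $\min\{\lambda_{U_{n-1}+1},\ldots,\lambda_{U_n}\}>0$. With $\mathcal S_n$ the symmetric group and $\chi(A)=1$ if $A$ is true and $0$ otherwise, $$\overline{\mathcal E}_n(x_1,y_1,\ldots,x_n,y_n)=(y_n+x_n)\sum_{\sigma\in\mathcal S_n}\prod_{i=1}^{n-1}\bigl(y_i^{\chi(\sigma(i)>\sigma(i+1))}+x_i\bigr),\qquad \mathcal E_n(y_1,\ldots,y_{n-1})=\sum_{\sigma\in\mathcal S_n}\prod_{i=1}^{n-1}y_i^{\chi(\sigma(i)>\sigma(i+1))}.$$ Empty products equal $1$. Identities are between formal power series in $q$ and the colors. *)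

theory Defs
  imports "HOL-Analysis.Analysis" "HOL-Library.Poly_Mapping"
    "HOL-Computational_Algebra.Formal_Power_Series" "HOL-Combinatorics.Permutations"
begin

text \<open>
  \<open>Plain k\<close> is the integer \<open>k \<ge> 0\<close>, \<open>Over k\<close> the over-lined integer of size \<open>k\<close>. Only the
  elements of \<open>parts\<close> below are meaningful: \<open>Over 0\<close> is a junk value.
\<close>
datatype part = Plain nat | Over nat

primrec psize :: "part \<Rightarrow> nat" where
  "psize (Plain k) = k"
| "psize (Over k) = k"

primrec overlined :: "part \<Rightarrow> bool" where
  "overlined (Plain k) = False"
| "overlined (Over k) = True"

definition parts :: "part set" where
  "parts = range Plain \<union> Over ` {1..}"

text \<open>On \<open>parts\<close> this is the order \<open>Plain 0 < Over 1 < Plain 1 < Over 2 < Plain 2 < \<dots>\<close>.\<close>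
instantiation part :: linorder
begin

definition less_eq_part :: "part \<Rightarrow> part \<Rightarrow> bool" where
  "a \<le> b \<longleftrightarrow> psize a < psize b \<or> (psize a = psize b \<and> (overlined a \<or> \<not> overlined b))"

definition less_part :: "part \<Rightarrow> part \<Rightarrow> bool" where
  "a < b \<longleftrightarrow> psize a < psize b \<or> (psize a = psize b \<and> overlined a \<and> \<not> overlined b)"

instance
proof
  fix a b c :: part
  show "(a < b) = (a \<le> b \<and> \<not> b \<le> a)" "a \<le> a" "a \<le> b \<or> b \<le> a"
    by (auto simp: less_eq_part_def less_part_def)
  show "a \<le> c" if "a \<le> b" "b \<le> c"
    using that by (auto simp: less_eq_part_def)
  show "a = b" if "a \<le> b" "b \<le> a"
    using that by (cases a; cases b) (auto simp: less_eq_part_def)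
qed

end

text \<open>
  A sequence \<open>(\<lambda>\<^sub>i)\<^bsub>i \<ge> 1\<^esub>\<close> is a function on \<open>nat\<close>; the unused value at index 0 is pinned to
  \<open>Plain 0\<close>, so that each sequence is represented by exactly one function.
\<close>
definition part_seqs :: "(nat \<Rightarrow> part) set" where
  "part_seqs = {l. l 0 = Plain 0
     \<and> (\<forall>i\<ge>1. l i \<in> parts)
     \<and> finite {i. i \<ge> 1 \<and> l i \<noteq> Plain 0}
     \<and> (\<forall>k\<ge>1. \<forall>i\<ge>1. \<forall>j\<ge>1. l i = Over k \<and> l j = Over k \<longrightarrow> i = j)
     \<and> (\<forall>k\<ge>1. \<forall>i\<ge>1. \<forall>j\<ge>1. l i = Over k \<and> l j = Plain k \<longrightarrow> j < i)}"

definition weight :: "(nat \<Rightarrow> part) \<Rightarrow> nat" where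
  "weight l = (\<Sum>i | i \<ge> 1 \<and> l i \<noteq> Plain 0. psize (l i))"

definition max_part :: "(nat \<Rightarrow> part) \<Rightarrow> part" where
  "max_part l = Max (l ` {1..})"

definition conjugate :: "(nat \<Rightarrow> part) \<Rightarrow> nat \<Rightarrow> part" where
  "conjugate l i =
     (let s = card {j. j \<ge> 1 \<and> l j \<ge> Over i}
      in if Over i \<in> l ` {1..} then Over s else Plain s)"

text \<open>
  Polynomials over the integers in the color indeterminates, which are indexed by \<open>part\<close>;
  monomials are finitely supported exponent functions.
\<close>
type_synonym color_poly = "(part \<Rightarrow>\<^sub>0 nat) \<Rightarrow>\<^sub>0 int"

definition color :: "part \<Rightarrow> color_poly" where
  "color p = Poly_Mapping.single (Poly_Mapping.single p 1) 1"

definition color_weight :: "(nat \<Rightarrow> part) \<Rightarrow> color_poly" where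
  "color_weight l = (\<Prod>i | i \<ge> 1 \<and> Over i \<le> max_part l. color (conjugate l i))"

definition gf_term :: "(nat \<Rightarrow> part) \<Rightarrow> color_poly fps" where
  "gf_term l = fps_const (color_weight l) * fps_X ^ weight l"

definition psum :: "(nat \<Rightarrow> nat) \<Rightarrow> nat \<Rightarrow> nat" where
  "psum u n = (\<Sum>i=1..n. u i)"

definition block :: "(nat \<Rightarrow> nat) \<Rightarrow> nat \<Rightarrow> nat set" where
  "block u n = {psum u (n - 1) + 1 .. psum u n}"

definition block_overpartitions :: "(nat \<Rightarrow> nat) \<Rightarrow> (nat \<Rightarrow> part) set" where
  "block_overpartitions u =
     {l \<in> part_seqs. \<forall>n\<ge>1. Min (l ` block u n) \<ge> Max (l ` block u (n + 1))}"

definition block_partitions :: "(nat \<Rightarrow> nat) \<Rightarrow> (nat \<Rightarrow> part) set" where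
  "block_partitions u = {l \<in> block_overpartitions u. \<forall>i\<ge>1. \<not> overlined (l i)}"

definition block_overpartitions_distinct :: "(nat \<Rightarrow> nat) \<Rightarrow> (nat \<Rightarrow> part) set" where
  "block_overpartitions_distinct u =
     {l \<in> block_overpartitions u. \<forall>n\<ge>1. Min (l ` block u n) > Plain 0 \<longrightarrow>
        int (psize (Min (l ` block u n))) - int (psize (Max (l ` block u (n + 1)))) > 0}"

text \<open>
  The arguments \<open>x\<^sub>1, \<dots>, x\<^sub>n\<close> and \<open>y\<^sub>1, \<dots>, y\<^sub>n\<close> are passed as functions of the index;
  \<open>Euler\<close> only uses \<open>y\<^sub>1, \<dots>, y\<^bsub>n-1\<^esub>\<close>.
\<close>
definition Euler_bar :: "nat \<Rightarrow> (nat \<Rightarrow> 'a::comm_ring_1) \<Rightarrow> (nat \<Rightarrow> 'a) \<Rightarrow> 'a" where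
  "Euler_bar n x y = (y n + x n) *
     (\<Sum>\<sigma> | \<sigma> permutes {1..n}. \<Prod>i=1..n - 1. (y i ^ of_bool (\<sigma> i > \<sigma> (i + 1)) + x i))"

definition Euler :: "nat \<Rightarrow> (nat \<Rightarrow> 'a::comm_ring_1) \<Rightarrow> 'a" where
  "Euler n y = (\<Sum>\<sigma> | \<sigma> permutes {1..n}. \<Prod>i=1..n - 1. y i ^ of_bool (\<sigma> i > \<sigma> (i + 1)))"

text \<open>
  The arguments \<open>c\<^sub>k q\<^sup>k\<close> attached to the \<open>n\<close>-th block (\<open>n \<ge> 1\<close>), where \<open>k = U\<^bsub>n-1\<^esub> + i\<close>:
  \<open>cq_over\<close> uses the over-lined and \<open>cq_plain\<close> the plain color of size \<open>k\<close>.
\<close>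
definition cq_over :: "(nat \<Rightarrow> nat) \<Rightarrow> nat \<Rightarrow> nat \<Rightarrow> color_poly fps" where
  "cq_over u n i =
     (let k = psum u (n - 1) + i in fps_const (color (Over k)) * fps_X ^ k)"

definition cq_plain :: "(nat \<Rightarrow> nat) \<Rightarrow> nat \<Rightarrow> nat \<Rightarrow> color_poly fps" where
  "cq_plain u n i =
     (let k = psum u (n - 1) + i in fps_const (color (Plain k)) * fps_X ^ k)"

text \<open>
  The quotient of power series whose denominator has constant term 1. The library division on
  \<open>fps\<close> is not available here because it needs an \<open>inverse\<close> operation on the coefficients.
\<close>
definition fps_frac :: "'a::comm_ring_1 fps \<Rightarrow> 'a fps \<Rightarrow> 'a fps" where
  "fps_frac f g = f * fps_right_inverse g 1"

lemma fps_frac_mult: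
  assumes "fps_nth g 0 = 1"
  shows "fps_frac f g * g = f"
  using fps_right_inverse[of g 1] assms by (simp add: fps_frac_def mult.left_commute mult.commute)

end

theory Submission
  imports Defs "HOL-Combinatorics.Multiset_Permutations"
begin

text \<open>
  A sequence is encoded by its level sets \<open>A\<^sub>i = {j. \<lambda>\<^sub>j \<ge> Over i}\<close>, a decreasing chain of sets each of
  which consists of some full blocks and a subset of the next one. The level set \<open>A\<^sub>i\<close> contributes
  the size \<open>|A\<^sub>i|\<close> to the weight and one color, over-lined only if \<open>A\<^sub>i \<noteq> A\<^bsub>i+1\<^esub>\<close>, since an over-lined
  part \<open>Over i\<close> can only sit at the last position of \<open>A\<^sub>i - A\<^bsub>i+1\<^esub>\<close>. Splitting off \<open>A\<^sub>1\<close> gives a linear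
  recursion for the generating function with prescribed \<open>A\<^sub>1\<close>: each distinct set \<open>A\<close> of size \<open>k\<close> in the
  chain has weight \<open>w\<^sub>k = (c\<^sub>k + c\<^sub>k') q\<^sup>k / (1 - c\<^sub>k q\<^sup>k)\<close>, where \<open>c\<^sub>k'\<close> is the over-lined color. Within
  one block the chains of subsets are counted by the permutations whose descents \<open>i\<close> carry \<open>w\<^sub>i\<close> and
  whose ascents carry \<open>1 + w\<^sub>i\<close>, which is the Eulerian sum.
\<close>

section \<open>Permutations counted by ascents\<close>

definition asc_prod :: "(nat \<Rightarrow> 'a::comm_ring_1) \<Rightarrow> nat list \<Rightarrow> 'a" where
  "asc_prod w xs = (\<Prod>i=1..length xs - 1. w i + of_bool (xs ! (i - 1) < xs ! i))"

definition asc_sum :: "(nat \<Rightarrow> 'a::comm_ring_1) \<Rightarrow> nat set \<Rightarrow> 'a" where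
  "asc_sum w S = (\<Sum>xs\<in>permutations_of_set S. asc_prod w xs)"

lemma prod_add_expand_last:
  fixes w a :: "nat \<Rightarrow> 'a::comm_ring_1"
  shows "(\<Prod>i=1..n. w i + a i) = (\<Prod>i=1..n. a i)
    + (\<Sum>j=1..n. (\<Prod>i=1..j - 1. w i + a i) * w j * (\<Prod>i=Suc j..n. a i))"
proof (induction n)
  case (Suc n)
  have "(\<Sum>j=1..n. (\<Prod>i=1..j - 1. w i + a i) * w j * (\<Prod>i=Suc j..Suc n. a i))
      = (\<Sum>j=1..n. (\<Prod>i=1..j - 1. w i + a i) * w j * (\<Prod>i=Suc j..n. a i)) * a (Suc n)"
    unfolding sum_distrib_right by (rule sum.cong) (auto simp: algebra_simps)
  then show ?case
    using Suc by (simp add: algebra_simps)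
qed simp

lemma prod_ascents_drop:
  fixes xs :: "nat list"
  assumes "length xs > 0"
  shows "(\<Prod>i=Suc j..length xs - 1. of_bool (xs ! (i - 1) < xs ! i))
    = (of_bool (sorted_wrt (<) (drop j xs)) :: 'a::comm_ring_1)"
proof -
  have "sorted_wrt (<) (drop j xs) \<longleftrightarrow> (\<forall>i\<in>{Suc j..length xs - 1}. xs ! (i - 1) < xs ! i)"
  proof -
    have "(\<forall>i\<in>{Suc j..length xs - 1}. xs ! (i - 1) < xs ! i)
      \<longleftrightarrow> (\<forall>i. Suc (j + i) < length xs \<longrightarrow> xs ! (j + i) < xs ! Suc (j + i))" (is "?l \<longleftrightarrow> ?r")
    proof
      assume ?l
      show ?r
      proof (intro allI impI)
        fix i assume "Suc (j + i) < length xs"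
        then have "Suc (j + i) \<in> {Suc j..length xs - 1}" by auto
        with \<open>?l\<close> show "xs ! (j + i) < xs ! Suc (j + i)" by fastforce
      qed
    next
      assume ?r
      show ?l
      proof
        fix i assume i: "i \<in> {Suc j..length xs - 1}"
        then have "i = Suc (j + (i - Suc j))" "Suc (j + (i - Suc j)) < length xs"
          using assms by auto
        with \<open>?r\<close> show "xs ! (i - 1) < xs ! i" by (metis diff_Suc_1)
      qed
    qed
    moreover have "Suc (j + i) < length xs \<longleftrightarrow> Suc i < length xs - j" for i by linarith
    ultimately show ?thesis
      by (subst sorted_wrt_iff_nth_Suc_transp) (auto simp: add.commute)
  qed
  moreover have "(\<Prod>i\<in>I. of_bool (P i)) = (of_bool (\<forall>i\<in>I. P i) :: 'a)" if "finite I" for I and P :: "nat \<Rightarrow> bool"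
    using that by (induction I rule: finite_induct) auto
  ultimately show ?thesis by simp
qed

lemma sum_permutations_sorted_drop:
  fixes g :: "nat list \<Rightarrow> 'a::comm_ring_1"
  assumes "finite S" "j \<le> card S"
  shows "(\<Sum>xs\<in>permutations_of_set S. of_bool (sorted_wrt (<) (drop j xs)) * g (take j xs))
    = (\<Sum>T | T \<subseteq> S \<and> card T = j. \<Sum>ys\<in>permutations_of_set T. g ys)"
proof -
  let ?X = "{xs \<in> permutations_of_set S. sorted_wrt (<) (drop j xs)}"
  have "(\<Sum>xs\<in>permutations_of_set S. of_bool (sorted_wrt (<) (drop j xs)) * g (take j xs))
    = (\<Sum>xs\<in>?X. g (take j xs))"
    by (rule sum.mono_neutral_cong_right) auto
  also have "\<dots> = (\<Sum>(T, ys)\<in>(SIGMA T:{T. T \<subseteq> S \<and> card T = j}. permutations_of_set T). g ys)"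
  proof (rule sum.reindex_bij_witness[where
      i = "\<lambda>(T, ys). ys @ sorted_list_of_set (S - T)" and j = "\<lambda>xs. (set (take j xs), take j xs)"])
    fix xs assume xs: "xs \<in> ?X"
    then have d: "distinct xs" and s: "set xs = S" and so: "sorted_wrt (<) (drop j xs)"
      by (auto simp: permutations_of_set_def)
    have "set (drop j xs) = S - set (take j xs)"
      using set_take_disj_set_drop_if_distinct[OF d order_refl, of j] s
        set_append[of "take j xs" "drop j xs"] by auto
    then have "sorted_list_of_set (S - set (take j xs)) = drop j xs"
      using so d by (metis distinct_drop sorted_list_of_set.idem_if_sorted_distinct strict_sorted_imp_sorted)
    then show "(case (set (take j xs), take j xs) of (T, ys) \<Rightarrow> ys @ sorted_list_of_set (S - T)) = xs"
      by simp
    have "length xs = card S" using d s distinct_card by metis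
    then show "(set (take j xs), take j xs) \<in> (SIGMA T:{T. T \<subseteq> S \<and> card T = j}. permutations_of_set T)"
      using d s assms by (auto simp: distinct_card permutations_of_set_def dest: in_set_takeD)
  next
    fix p assume p: "p \<in> (SIGMA T:{T. T \<subseteq> S \<and> card T = j}. permutations_of_set T)"
    obtain T ys where [simp]: "p = (T, ys)" by (cases p)
    have T: "T \<subseteq> S" "card T = j" and ys: "set ys = T" "distinct ys"
      using p by (auto simp: permutations_of_set_def)
    then have l: "length ys = j" by (metis distinct_card)
    then show "(\<lambda>xs. (set (take j xs), take j xs)) (case p of (T, ys) \<Rightarrow> ys @ sorted_list_of_set (S - T)) = p"
      by (simp add: ys)
    show "(case p of (T, ys) \<Rightarrow> ys @ sorted_list_of_set (S - T)) \<in> ?X"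
      using assms T ys l by (auto simp: permutations_of_set_def)
  qed auto
  also have "\<dots> = (\<Sum>T | T \<subseteq> S \<and> card T = j. \<Sum>ys\<in>permutations_of_set T. g ys)"
    using assms by (subst sum.Sigma) (auto intro: finite_subset)
  finally show ?thesis .
qed

text \<open>Expanding the product at its last factor \<open>w j\<close> leaves an increasing tail, which is
  determined by its set of values.\<close>
lemma asc_sum_rec:
  assumes "finite S" "S \<noteq> {}"
  shows "asc_sum w S = 1 + (\<Sum>T | T \<subset> S \<and> T \<noteq> {}. w (card T) * asc_sum w T)"
proof -
  define n where "n = card S"
  have n: "n > 0" using assms by (simp add: n_def card_gt_0_iff)
  have exp: "asc_prod w xs = of_bool (sorted_wrt (<) (drop 0 xs)) * 1
      + (\<Sum>j=1..n - 1. w j * (of_bool (sorted_wrt (<) (drop j xs)) * asc_prod w (take j xs)))"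
    if "xs \<in> permutations_of_set S" for xs
  proof -
    have l: "length xs = n"
      using that by (auto simp: n_def permutations_of_set_def distinct_card)
    let ?a = "\<lambda>i. of_bool (xs ! (i - 1) < xs ! i)"
    have "asc_prod w xs = (\<Prod>i=1..n - 1. ?a i)
      + (\<Sum>j=1..n - 1. (\<Prod>i=1..j - 1. w i + ?a i) * w j * (\<Prod>i=Suc j..n - 1. ?a i))"
      unfolding asc_prod_def l by (rule prod_add_expand_last)
    also have "(\<Prod>i=1..n - 1. ?a i) = (of_bool (sorted_wrt (<) (drop 0 xs)) :: 'a)"
      using prod_ascents_drop[of xs 0, where ?'a = 'a] l n by (simp del: of_bool_eq_iff)
    also have "(\<Sum>j=1..n - 1. (\<Prod>i=1..j - 1. w i + ?a i) * w j * (\<Prod>i=Suc j..n - 1. ?a i))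
      = (\<Sum>j=1..n - 1. w j * (of_bool (sorted_wrt (<) (drop j xs)) * asc_prod w (take j xs)))"
    proof (rule sum.cong)
      fix j assume j: "j \<in> {1..n - 1}"
      have "asc_prod w (take j xs) = (\<Prod>i=1..j - 1. w i + ?a i)"
        unfolding asc_prod_def using j l by (intro prod.cong) auto
      then show "(\<Prod>i=1..j - 1. w i + ?a i) * w j * (\<Prod>i=Suc j..n - 1. ?a i)
        = w j * (of_bool (sorted_wrt (<) (drop j xs)) * asc_prod w (take j xs))"
        using prod_ascents_drop[of xs j, where ?'a = 'a] l n by simp
    qed simp
    finally show ?thesis by simp
  qed
  have "asc_sum w S = (\<Sum>xs\<in>permutations_of_set S. of_bool (sorted_wrt (<) (drop 0 xs)) * 1)
      + (\<Sum>j=1..n - 1. w j * (\<Sum>xs\<in>permutations_of_set S.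
          of_bool (sorted_wrt (<) (drop j xs)) * asc_prod w (take j xs)))"
    unfolding asc_sum_def
    by (subst sum.cong[OF refl exp], assumption, subst sum.distrib, subst sum.swap)
      (simp only: sum_distrib_left)
  also have "(\<Sum>xs\<in>permutations_of_set S. of_bool (sorted_wrt (<) (drop 0 xs)) * 1)
    = (\<Sum>T | T \<subseteq> S \<and> card T = 0. \<Sum>ys\<in>permutations_of_set T. (1::'a))"
    using sum_permutations_sorted_drop[OF assms(1), of 0 "\<lambda>_. 1::'a"] by simp
  also have "{T. T \<subseteq> S \<and> card T = 0} = {{}}"
    using assms(1) finite_subset by fastforce
  also have "(\<Sum>j=1..n - 1. w j * (\<Sum>xs\<in>permutations_of_set S.
        of_bool (sorted_wrt (<) (drop j xs)) * asc_prod w (take j xs)))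
    = (\<Sum>j=1..n - 1. \<Sum>T | T \<subseteq> S \<and> card T = j. w (card T) * asc_sum w T)"
  proof (rule sum.cong)
    fix j assume "j \<in> {1..n - 1}"
    then have "j \<le> card S" unfolding n_def by auto
    then show "w j * (\<Sum>xs\<in>permutations_of_set S.
        of_bool (sorted_wrt (<) (drop j xs)) * asc_prod w (take j xs))
      = (\<Sum>T | T \<subseteq> S \<and> card T = j. w (card T) * asc_sum w T)"
      by (subst sum_permutations_sorted_drop[OF assms(1)]) (auto simp: asc_sum_def sum_distrib_left)
  qed simp
  also have "\<dots> = (\<Sum>T\<in>(\<Union>j\<in>{1..n - 1}. {T. T \<subseteq> S \<and> card T = j}). w (card T) * asc_sum w T)"
    using assms(1) by (subst sum.UNION_disjoint) auto
  also have "(\<Union>j\<in>{1..n - 1}. {T. T \<subseteq> S \<and> card T = j}) = {T. T \<subset> S \<and> T \<noteq> {}}"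
  proof -
    have "card T \<in> {1..n - 1} \<longleftrightarrow> T \<subset> S \<and> T \<noteq> {}" if "T \<subseteq> S" for T
    proof -
      have "finite T" using that assms(1) finite_subset by blast
      moreover have "card T \<le> n" using that assms(1) card_mono n_def by blast
      moreover have "card T = n \<longleftrightarrow> T = S" using that assms(1) card_subset_eq n_def by blast
      moreover have "card T \<in> {1..n - 1} \<longleftrightarrow> card T \<noteq> 0 \<and> card T \<noteq> n" if "card T \<le> n"
        using that n by auto
      ultimately show ?thesis using that by auto
    qed
    moreover have "(\<Union>j\<in>{1..n - 1}. {T. T \<subseteq> S \<and> card T = j}) = {T. T \<subseteq> S \<and> card T \<in> {1..n - 1}}"
      by blast
    ultimately show ?thesis by blast
  qed
  finally show ?thesis by simp
qed

lemma sum_permutes_eq_sum_permutations: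
  fixes h :: "nat \<Rightarrow> bool \<Rightarrow> 'a::comm_ring_1"
  shows "(\<Sum>\<sigma> | \<sigma> permutes {1..n}. \<Prod>i=1..n - 1. h i (\<sigma> i > \<sigma> (i + 1)))
    = (\<Sum>xs\<in>permutations_of_set {m + 1..m + n}. \<Prod>i=1..n - 1. h i (xs ! (i - 1) > xs ! i))"
proof (rule sum.reindex_bij_witness[where
      i = "\<lambda>xs i. if i \<in> {1..n} then xs ! (i - 1) - m else i"
      and j = "\<lambda>\<sigma>. map (\<lambda>i. m + \<sigma> (i + 1)) [0..<n]"])
  fix \<sigma> assume "\<sigma> \<in> {\<sigma>. \<sigma> permutes {1..n}}"
  then have p: "\<sigma> permutes {1..n}" by simp
  show "(\<lambda>i. if i \<in> {1..n} then map (\<lambda>i. m + \<sigma> (i + 1)) [0..<n] ! (i - 1) - m else i) = \<sigma>"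
    using permutes_not_in[OF p] by fastforce
  have "(\<lambda>i. m + \<sigma> (i + 1)) ` {0..<n} = (\<lambda>i. m + i) ` \<sigma> ` Suc ` {0..<n}"
    by (simp add: image_image del: image_Suc_atLeastLessThan)
  also have "Suc ` {0..<n} = {1..n}"
    by (simp add: image_Suc_atLeastLessThan atLeastLessThanSuc_atLeastAtMost)
  also have "\<sigma> ` {1..n} = {1..n}" using p by (rule permutes_image)
  also have "(\<lambda>i. m + i) ` {1..n} = {m + 1..m + n}" by (simp add: add.commute)
  finally have "set (map (\<lambda>i. m + \<sigma> (i + 1)) [0..<n]) = {m + 1..m + n}" by simp
  moreover have "inj \<sigma>" using p by (rule permutes_inj)
  ultimately show "map (\<lambda>i. m + \<sigma> (i + 1)) [0..<n] \<in> permutations_of_set {m + 1..m + n}"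
    by (auto simp: permutations_of_set_def distinct_map inj_on_def)
  show "(\<Prod>i=1..n - 1. h i (map (\<lambda>i. m + \<sigma> (i + 1)) [0..<n] ! (i - 1) > map (\<lambda>i. m + \<sigma> (i + 1)) [0..<n] ! i))
    = (\<Prod>i=1..n - 1. h i (\<sigma> i > \<sigma> (i + 1)))"
    by (intro prod.cong) auto
next
  fix xs assume "xs \<in> permutations_of_set {m + 1..m + n}"
  then have s: "set xs = {m + 1..m + n}" and d: "distinct xs"
    by (auto simp: permutations_of_set_def)
  have l: "length xs = n" using distinct_card[OF d] s by simp
  have mem: "m + 1 \<le> xs ! i" "xs ! i \<le> m + n" if "i < n" for i
    using nth_mem[of i xs] that s l by auto
  show "map (\<lambda>i. m + (if i + 1 \<in> {1..n} then xs ! (i + 1 - 1) - m else i + 1)) [0..<n] = xs"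
    using mem l by (intro nth_equalityI) (auto simp: le_add_diff_inverse Suc_le_eq less_imp_le)
  let ?s = "\<lambda>i. if i \<in> {1..n} then xs ! (i - 1) - m else i"
  have "inj_on ?s {1..n}"
  proof (rule inj_onI)
    fix i k assume ik: "i \<in> {1..n}" "k \<in> {1..n}" "?s i = ?s k"
    then have "xs ! (i - 1) - m = xs ! (k - 1) - m" by simp
    moreover have "i - 1 < n" "k - 1 < n" using ik by auto
    ultimately have "xs ! (i - 1) = xs ! (k - 1)" using mem(1)[of "i - 1"] mem(1)[of "k - 1"] by linarith
    then have "i - 1 = k - 1" using ik d l by (subst (asm) nth_eq_iff_index_eq) auto
    then show "i = k" using ik by auto
  qed
  moreover have "?s ` {1..n} \<subseteq> {1..n}"
  proof
    fix k assume "k \<in> ?s ` {1..n}"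
    then obtain i where i: "i \<in> {1..n}" "k = xs ! (i - 1) - m" by auto
    moreover have "i - 1 < n" using i by auto
    ultimately show "k \<in> {1..n}" using mem[of "i - 1"] by auto
  qed
  ultimately have "bij_betw ?s {1..n} {1..n}"
    unfolding bij_betw_def using endo_inj_surj[OF finite_atLeastAtMost] by blast
  then have "?s permutes {1..n}" by (rule bij_imp_permutes) auto
  then show "?s \<in> {\<sigma>. \<sigma> permutes {1..n}}" by simp
qed

lemma Euler_sum_eq_asc_sum:
  fixes x z r :: "nat \<Rightarrow> 'a::comm_ring_1"
  assumes r: "\<And>i. i \<ge> 1 \<Longrightarrow> (1 - z i) * r i = 1"
  shows "(\<Sum>\<sigma> | \<sigma> permutes {1..n}. \<Prod>i=1..n - 1. (z i ^ of_bool (\<sigma> i > \<sigma> (i + 1)) + x i))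
    * (\<Prod>i=1..n - 1. r i) = asc_sum (\<lambda>i. (z i + x i) * r i) {m + 1..m + n}"
proof -
  have "(\<Sum>\<sigma> | \<sigma> permutes {1..n}. \<Prod>i=1..n - 1. (z i ^ of_bool (\<sigma> i > \<sigma> (i + 1)) + x i))
      * (\<Prod>i=1..n - 1. r i)
    = (\<Sum>xs\<in>permutations_of_set {m + 1..m + n}.
        \<Prod>i=1..n - 1. (z i ^ of_bool (xs ! (i - 1) > xs ! i) + x i)) * (\<Prod>i=1..n - 1. r i)"
    by (rule arg_cong[where f = "\<lambda>t. t * _"],
      rule sum_permutes_eq_sum_permutations[where h = "\<lambda>i b. z i ^ of_bool b + x i"])
  also have "\<dots> = asc_sum (\<lambda>i. (z i + x i) * r i) {m + 1..m + n}"
    unfolding asc_sum_def sum_distrib_right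
  proof (rule sum.cong)
    fix xs assume "xs \<in> permutations_of_set {m + 1..m + n}"
    then have s: "set xs = {m + 1..m + n}" and d: "distinct xs"
      by (auto simp: permutations_of_set_def)
    have l: "length xs = n" using distinct_card[OF d] s by simp
    show "(\<Prod>i=1..n - 1. (z i ^ of_bool (xs ! (i - 1) > xs ! i) + x i)) * (\<Prod>i=1..n - 1. r i)
      = asc_prod (\<lambda>i. (z i + x i) * r i) xs"
      unfolding asc_prod_def l prod.distrib[symmetric]
    proof (rule prod.cong)
      fix i assume i: "i \<in> {1..n - 1}"
      then have "xs ! (i - 1) \<noteq> xs ! i" using d l by (subst nth_eq_iff_index_eq) auto
      moreover have "(1 + x i) * r i = (z i + x i) * r i + (1 - z i) * r i"
        by (simp add: algebra_simps)
      ultimately show "(z i ^ of_bool (xs ! (i - 1) > xs ! i) + x i) * r i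
        = (z i + x i) * r i + of_bool (xs ! (i - 1) < xs ! i)"
        using r[of i] i by (cases "xs ! (i - 1) < xs ! i") auto
    qed simp
  qed simp
  finally show ?thesis .
qed

section \<open>Level sets of block over-partitions\<close>

lemma part_eq_iff: "a = b \<longleftrightarrow> psize a = psize b \<and> overlined a = overlined b"
  by (cases a; cases b) auto

lemma Over_le_iff: "Over i \<le> a \<longleftrightarrow> i \<le> psize a"
  by (auto simp: less_eq_part_def)

lemma mem_part_seqs_iff:
  "l \<in> part_seqs \<longleftrightarrow> l 0 = Plain 0 \<and> (\<forall>i. overlined (l i) \<longrightarrow> psize (l i) > 0)
    \<and> finite {i. psize (l i) \<noteq> 0}
    \<and> (\<forall>i j. overlined (l i) \<and> psize (l j) = psize (l i) \<longrightarrow> j \<le> i)"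
proof
  have parts: "a \<in> parts \<longleftrightarrow> (overlined a \<longrightarrow> psize a > 0)" for a
    by (cases a) (auto simp: parts_def)
  have Over: "a = Over k \<longleftrightarrow> overlined a \<and> psize a = k" for a k by (cases a) auto
  have Plain: "a = Plain k \<longleftrightarrow> \<not> overlined a \<and> psize a = k" for a k by (cases a) auto
  {
    assume l: "l \<in> part_seqs"
    then have l0: "l 0 = Plain 0"
      and pos: "\<And>i. i \<ge> 1 \<Longrightarrow> overlined (l i) \<Longrightarrow> psize (l i) > 0"
      and fin: "finite {i. i \<ge> 1 \<and> l i \<noteq> Plain 0}"
      and uniq: "\<And>i j k. k \<ge> 1 \<Longrightarrow> i \<ge> 1 \<Longrightarrow> j \<ge> 1 \<Longrightarrow> l i = Over k \<Longrightarrow> l j = Over k \<Longrightarrow> i = j"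
      and aft: "\<And>i j k. k \<ge> 1 \<Longrightarrow> i \<ge> 1 \<Longrightarrow> j \<ge> 1 \<Longrightarrow> l i = Over k \<Longrightarrow> l j = Plain k \<Longrightarrow> j < i"
      unfolding part_seqs_def by (auto simp: parts)
    have pos': "psize (l i) > 0" if "overlined (l i)" for i
      using pos[of i] that l0 by (cases "i = 0") auto
    have "{i. psize (l i) \<noteq> 0} \<subseteq> {i. i \<ge> 1 \<and> l i \<noteq> Plain 0}"
      using l0 by (auto simp: Suc_le_eq intro!: gr0I)
    then have "finite {i. psize (l i) \<noteq> 0}" using fin finite_subset by blast
    moreover have "j \<le> i" if "overlined (l i)" "psize (l j) = psize (l i)" for i j
    proof (cases "j = 0")
      case False
      have "i \<noteq> 0" using that l0 by (auto intro!: gr0I)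
      then show ?thesis
        using False that uniq[of "psize (l i)" i j] aft[of "psize (l i)" i j] pos'[of i]
        by (cases "overlined (l j)") (auto simp: Over Plain)
    qed simp
    ultimately show "l 0 = Plain 0 \<and> (\<forall>i. overlined (l i) \<longrightarrow> psize (l i) > 0)
      \<and> finite {i. psize (l i) \<noteq> 0}
      \<and> (\<forall>i j. overlined (l i) \<and> psize (l j) = psize (l i) \<longrightarrow> j \<le> i)"
      using l0 pos' by blast
  next
    assume *: "l 0 = Plain 0 \<and> (\<forall>i. overlined (l i) \<longrightarrow> psize (l i) > 0)
      \<and> finite {i. psize (l i) \<noteq> 0}
      \<and> (\<forall>i j. overlined (l i) \<and> psize (l j) = psize (l i) \<longrightarrow> j \<le> i)"
    have "{i. i \<ge> 1 \<and> l i \<noteq> Plain 0} \<subseteq> {i. psize (l i) \<noteq> 0}"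
      using * by (auto simp: Plain)
    then have "finite {i. i \<ge> 1 \<and> l i \<noteq> Plain 0}" using * finite_subset by blast
    moreover have "j < i" if "l i = Over k" "l j = Plain k" for i j k
    proof -
      have "j \<le> i" using * that by simp
      moreover have "j \<noteq> i" using that by auto
      ultimately show ?thesis by simp
    qed
    moreover have "i = j" if "l i = Over k" "l j = Over k" for i j k
      using * that by (simp add: le_antisym)
    ultimately show "l \<in> part_seqs"
      using * unfolding part_seqs_def by (auto simp: parts)
  }
qed

definition support :: "(nat \<Rightarrow> part) \<Rightarrow> nat set" where
  "support l = {i. psize (l i) \<noteq> 0}"

lemma part_seqs_support:
  assumes "l \<in> part_seqs"
  shows "finite (support l)" "0 \<notin> support l" "{i. i \<ge> 1 \<and> l i \<noteq> Plain 0} = support l"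
proof -
  show "finite (support l)" "0 \<notin> support l"
    using assms by (auto simp: mem_part_seqs_iff support_def)
  then show "{i. i \<ge> 1 \<and> l i \<noteq> Plain 0} = support l"
    using assms by (auto simp: mem_part_seqs_iff support_def part_eq_iff Suc_le_eq intro!: gr0I)
qed

lemma weight_eq_sum_support: "l \<in> part_seqs \<Longrightarrow> weight l = (\<Sum>i\<in>support l. psize (l i))"
  by (simp add: weight_def part_seqs_support(3)[simplified])

definition mk_part :: "nat \<Rightarrow> bool \<Rightarrow> part" where
  "mk_part s ov = (if ov then Over s else Plain s)"

lemma psize_mk_part [simp]: "psize (mk_part s ov) = s"
  and overlined_mk_part [simp]: "overlined (mk_part s ov) = ov"
  by (simp_all add: mk_part_def)

lemma color_weight_eq_prod:
  assumes "l \<in> part_seqs"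
  shows "color_weight l = (\<Prod>i | i \<ge> 1 \<and> (\<exists>j. i \<le> psize (l j)).
    color (mk_part (card {j. i \<le> psize (l j)}) (\<exists>j. l j = Over i)))"
  unfolding color_weight_def
proof (rule prod.cong)
  note l = assms[unfolded mem_part_seqs_iff]
  have "range l \<subseteq> insert (Plain 0) (l ` {i. psize (l i) \<noteq> 0})"
    using l by (auto simp: part_eq_iff)
  then have "finite (l ` {1..})"
    using l by (meson finite_imageI finite_insert finite_subset image_mono subset_UNIV subset_trans)
  then have "Over i \<le> max_part l \<longleftrightarrow> (\<exists>j\<ge>1. i \<le> psize (l j))" for i
    unfolding max_part_def by (subst Max_ge_iff) (auto simp: Over_le_iff)
  moreover have "(\<exists>j\<ge>1. i \<le> psize (l j)) \<longleftrightarrow> (\<exists>j. i \<le> psize (l j))" if "i \<ge> 1" for i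
  proof -
    have "j \<ge> 1" if "i \<le> psize (l j)" for j
      using l that \<open>i \<ge> 1\<close> by (cases j) auto
    then show ?thesis by blast
  qed
  ultimately show "{i. i \<ge> 1 \<and> Over i \<le> max_part l} = {i. i \<ge> 1 \<and> (\<exists>j. i \<le> psize (l j))}"
    by blast
  fix i assume "i \<in> {i. i \<ge> 1 \<and> (\<exists>j. i \<le> psize (l j))}"
  then have i: "i \<ge> 1" by simp
  have "{j. j \<ge> 1 \<and> i \<le> psize (l j)} = {j. i \<le> psize (l j)}"
    using l i by (auto simp: Suc_le_eq intro!: gr0I)
  moreover have "Over i \<in> l ` {1..} \<longleftrightarrow> (\<exists>j. l j = Over i)"
    using l by (auto simp: image_iff Bex_def Suc_le_eq) (metis gr0I part.distinct(1))
  ultimately show "color (conjugate l i) = color (mk_part (card {j. i \<le> psize (l j)}) (\<exists>j. l j = Over i))"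
    by (simp add: conjugate_def Let_def Over_le_iff mk_part_def)
qed

definition compat :: "(nat \<Rightarrow> nat) \<Rightarrow> nat set \<Rightarrow> bool" where
  "compat u A \<longleftrightarrow> finite A \<and> 0 \<notin> A \<and> (\<forall>n. A \<subseteq> {1..psum u n} \<or> {1..psum u n} \<subseteq> A)"

text \<open>\<open>below u st A B\<close> says that \<open>B\<close> may follow \<open>A\<close> in the chain of level sets. Throughout, the flag
  \<open>st\<close> demands strict decrease between blocks and \<open>ov\<close> permits over-lined parts.\<close>
definition below :: "(nat \<Rightarrow> nat) \<Rightarrow> bool \<Rightarrow> nat set \<Rightarrow> nat set \<Rightarrow> bool" where
  "below u st A B \<longleftrightarrow> B \<subseteq> A \<and> compat u B \<and> (st \<longrightarrow> (\<forall>n. A \<subseteq> {1..psum u n} \<or> {1..psum u n} \<subseteq> B))"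

definition block_seqs :: "(nat \<Rightarrow> nat) \<Rightarrow> bool \<Rightarrow> bool \<Rightarrow> (nat \<Rightarrow> part) set" where
  "block_seqs u ov st = {l \<in> part_seqs. (ov \<or> (\<forall>i. \<not> overlined (l i)))
    \<and> (\<forall>n j k. 1 \<le> j \<and> j \<le> psum u n \<and> psum u n < k \<longrightarrow>
        psize (l k) \<le> psize (l j) \<and> (st \<longrightarrow> psize (l k) = 0 \<or> psize (l k) < psize (l j)))}"

lemma block_seqsD:
  assumes "l \<in> block_seqs u ov st"
  shows "l \<in> part_seqs" "\<And>i. overlined (l i) \<Longrightarrow> ov"
    and "\<And>n j k. 1 \<le> j \<Longrightarrow> j \<le> psum u n \<Longrightarrow> psum u n < k \<Longrightarrow> psize (l k) \<le> psize (l j)"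
    and "\<And>n j k. 1 \<le> j \<Longrightarrow> j \<le> psum u n \<Longrightarrow> psum u n < k \<Longrightarrow> st \<Longrightarrow> psize (l k) \<noteq> 0 \<Longrightarrow> psize (l k) < psize (l j)"
proof -
  show "l \<in> part_seqs" "\<And>i. overlined (l i) \<Longrightarrow> ov"
    using assms by (auto simp: block_seqs_def)
  fix n j k assume "1 \<le> j" "j \<le> psum u n" "psum u n < k"
  then have "psize (l k) \<le> psize (l j) \<and> (st \<longrightarrow> psize (l k) = 0 \<or> psize (l k) < psize (l j))"
    using assms by (simp add: block_seqs_def)
  then show "psize (l k) \<le> psize (l j)" "st \<Longrightarrow> psize (l k) \<noteq> 0 \<Longrightarrow> psize (l k) < psize (l j)"
    by auto
qed

lemma compat_support:
  assumes "l \<in> block_seqs u ov st"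
  shows "compat u (support l)"
  unfolding compat_def
proof (intro conjI allI)
  note l = block_seqsD[OF assms]
  show "finite (support l)" "0 \<notin> support l" using part_seqs_support[OF l(1)] by auto
  fix n
  show "support l \<subseteq> {1..psum u n} \<or> {1..psum u n} \<subseteq> support l"
  proof (rule disjCI)
    assume "\<not> {1..psum u n} \<subseteq> support l"
    then obtain j where "j \<in> {1..psum u n}" "j \<notin> support l" by blast
    then have j: "1 \<le> j" "j \<le> psum u n" "psize (l j) = 0" by (auto simp: support_def)
    show "support l \<subseteq> {1..psum u n}"
    proof
      fix k assume k: "k \<in> support l"
      then have "k \<noteq> 0" using \<open>0 \<notin> support l\<close> by metis
      moreover have "\<not> psum u n < k" using l(3)[OF j(1,2), of k] k j(3) by (auto simp: support_def)
      ultimately show "k \<in> {1..psum u n}" by auto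
    qed
  qed
qed

definition lower :: "(nat \<Rightarrow> part) \<Rightarrow> nat \<Rightarrow> part" where
  "lower l j = mk_part (psize (l j) - 1) (overlined (l j) \<and> 2 \<le> psize (l j))"

definition raise :: "nat set \<Rightarrow> bool \<Rightarrow> (nat \<Rightarrow> part) \<Rightarrow> nat \<Rightarrow> part" where
  "raise A b l j = mk_part (if j \<in> A then Suc (psize (l j)) else 0)
     (j \<in> A \<and> (overlined (l j) \<or> b \<and> j = Max (A - support l)))"

lemma support_raise [simp]: "support (raise A b l) = A"
  by (auto simp: support_def raise_def)

lemma lower_block_seqs:
  assumes "l \<in> block_seqs u ov st"
  shows "lower l \<in> block_seqs u ov st"
proof -
  note l = block_seqsD[OF assms]
  note ps = l(1)[unfolded mem_part_seqs_iff]
  have "{i. psize (lower l i) \<noteq> 0} \<subseteq> {i. psize (l i) \<noteq> 0}"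
    by (auto simp: lower_def)
  then have "finite {i. psize (lower l i) \<noteq> 0}" using ps finite_subset by blast
  moreover have "j \<le> i" if "overlined (lower l i)" "psize (lower l j) = psize (lower l i)" for i j
  proof -
    have "overlined (l i)" "psize (l j) = psize (l i)" using that by (auto simp: lower_def)
    then show ?thesis using ps by blast
  qed
  moreover have "lower l 0 = Plain 0" using ps by (simp add: lower_def mk_part_def)
  moreover have "psize (lower l i) > 0" if "overlined (lower l i)" for i
    using that by (simp add: lower_def)
  ultimately have "lower l \<in> part_seqs"
    unfolding mem_part_seqs_iff by blast
  moreover have "ov \<or> (\<forall>i. \<not> overlined (lower l i))" using l(2) by (auto simp: lower_def)
  moreover have "psize (lower l k) \<le> psize (lower l j)
      \<and> (st \<longrightarrow> psize (lower l k) = 0 \<or> psize (lower l k) < psize (lower l j))"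
    if "1 \<le> j \<and> j \<le> psum u n \<and> psum u n < k" for n j k
  proof -
    have "psize (l k) \<le> psize (l j)" "st \<Longrightarrow> psize (l k) \<noteq> 0 \<Longrightarrow> psize (l k) < psize (l j)"
      using l(3)[of j n k] l(4)[of j n k] that by auto
    then show ?thesis unfolding lower_def psize_mk_part by linarith
  qed
  ultimately show ?thesis by (auto simp: block_seqs_def)
qed

lemma below_support_lower:
  assumes "l \<in> block_seqs u ov st"
  shows "below u st (support l) (support (lower l))"
proof -
  note l = block_seqsD[OF assms]
  have "{1..psum u n} \<subseteq> support (lower l)" if st and n: "\<not> support l \<subseteq> {1..psum u n}" for n
  proof
    fix j assume j: "j \<in> {1..psum u n}"
    obtain k where "k \<in> support l" "k \<notin> {1..psum u n}" using n by blast
    then have k: "psize (l k) \<noteq> 0" "\<not> (1 \<le> k \<and> k \<le> psum u n)" by (auto simp: support_def)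
    then have "psum u n < k" using part_seqs_support(2)[OF l(1)] by (cases "k = 0") (auto simp: support_def)
    then show "j \<in> support (lower l)"
      using l(4)[of j n k] \<open>st\<close> j k by (auto simp: support_def lower_def)
  qed
  then show ?thesis
    using compat_support[OF lower_block_seqs[OF assms]]
    by (auto simp: below_def support_def lower_def)
qed

lemma raise_lower:
  assumes "l \<in> part_seqs"
  shows "raise (support l) (\<exists>j. l j = Over 1) (lower l) = l"
proof
  note ps = assms[unfolded mem_part_seqs_iff]
  fix j
  have eq: "support l - support (lower l) = {j. psize (l j) = 1}"
    by (auto simp: support_def lower_def)
  have Over: "l d = Over 1 \<longleftrightarrow> overlined (l d) \<and> psize (l d) = 1" for d
    by (auto simp: part_eq_iff)
  have Max: "d = Max {j. psize (l j) = 1}" if "l d = Over 1" for d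
  proof (rule Max_eqI[symmetric])
    show "finite {j. psize (l j) = 1}"
      by (rule finite_subset[of _ "{i. psize (l i) \<noteq> 0}"]) (use ps in auto)
    show "j \<le> d" if "j \<in> {j. psize (l j) = 1}" for j
      using ps that \<open>l d = Over 1\<close> by simp
  qed (use that in auto)
  have "overlined (l j) \<longleftrightarrow> j \<in> support l \<and> (overlined (lower l j) \<or>
      (\<exists>j. l j = Over 1) \<and> j = Max {j. psize (l j) = 1})"
  proof -
    have ov: "overlined (lower l j) \<longleftrightarrow> overlined (l j) \<and> 2 \<le> psize (l j)" by (simp add: lower_def)
    have "overlined (l j) \<Longrightarrow> psize (l j) > 0" using ps by blast
    moreover have "overlined (l j)" if "l d = Over 1" "j = Max {j. psize (l j) = 1}" for d
      using Max[OF that(1)] that by simp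
    moreover have "\<exists>d. l d = Over 1" "j = Max {j. psize (l j) = 1}" if "overlined (l j)" "psize (l j) = 1"
      using that Max[of j] Over[of j] by auto
    moreover have "psize (l j) = 0 \<or> psize (l j) = 1 \<or> 2 \<le> psize (l j)" by linarith
    ultimately show ?thesis unfolding ov support_def by auto
  qed
  then show "raise (support l) (\<exists>j. l j = Over 1) (lower l) j = l j"
    unfolding raise_def eq part_eq_iff by (auto simp: support_def lower_def)
qed

lemma raise_block_seqs_inverse:
  assumes l: "l \<in> block_seqs u ov st" and A: "compat u A" "below u st A (support l)"
    and b: "b \<Longrightarrow> ov \<and> support l \<noteq> A"
  shows "raise A b l \<in> block_seqs u ov st" "lower (raise A b l) = l"
    and "(\<exists>j. raise A b l j = Over 1) \<longleftrightarrow> b"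
proof -
  note lD = block_seqsD[OF l]
  note ps = lD(1)[unfolded mem_part_seqs_iff]
  define d where "d = Max (A - support l)"
  have fin: "finite A" "0 \<notin> A" using A(1) by (auto simp: compat_def)
  have sub: "support l \<subseteq> A" using A(2) by (simp add: below_def)
  have d: "d \<in> A - support l" if b
    unfolding d_def using b[OF that] fin sub by (intro Max_in) auto
  have dmax: "j \<le> d" if "j \<in> A" "psize (l j) = 0" for j
    unfolding d_def using that fin by (intro Max_ge) (auto simp: support_def)
  have outside: "l j = Plain 0" if "j \<notin> A" for j
    using that sub ps by (auto simp: support_def part_eq_iff)
  have psz: "psize (raise A b l j) = (if j \<in> A then Suc (psize (l j)) else 0)" for j
    by (simp add: raise_def)
  have ovl: "overlined (raise A b l j) \<longleftrightarrow> overlined (l j) \<or> b \<and> j = d" for j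
    using d outside[of j] by (cases "j \<in> A") (auto simp: raise_def simp flip: d_def)
  have "finite {i. psize (raise A b l i) \<noteq> 0}" using fin by (simp add: psz)
  moreover have "j \<le> i" if "overlined (raise A b l i)" "psize (raise A b l j) = psize (raise A b l i)" for i j
  proof (cases "overlined (l i)")
    case True
    then have "i \<in> A" using outside[of i] by (cases "i \<in> A") auto
    then show ?thesis using True ps that psz by (auto split: if_splits)
  next
    case False
    then have "b" "i = d" using that ovl by auto
    then have "d \<in> A" "psize (l d) = 0" using d by (auto simp: support_def)
    then have "psize (raise A b l j) = 1" using that(2) unfolding \<open>i = d\<close> psz[of d] by simp
    then have "j \<in> A" "psize (l j) = 0" unfolding psz by (auto split: if_splits)
    then show ?thesis using dmax \<open>i = d\<close> by auto
  qed
  moreover have "psize (raise A b l i) > 0" if "overlined (raise A b l i)" for i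
    using that by (auto simp: raise_def)
  moreover have "raise A b l 0 = Plain 0" using fin by (auto simp: raise_def mk_part_def)
  ultimately have "raise A b l \<in> part_seqs" unfolding mem_part_seqs_iff by blast
  moreover have "ov \<or> (\<forall>i. \<not> overlined (raise A b l i))" using lD(2) b by (auto simp: ovl)
  moreover have "psize (raise A b l k) \<le> psize (raise A b l j)
      \<and> (st \<longrightarrow> psize (raise A b l k) = 0 \<or> psize (raise A b l k) < psize (raise A b l j))"
    if *: "1 \<le> j \<and> j \<le> psum u n \<and> psum u n < k" for n j k
  proof (cases "k \<in> A")
    case True
    then have n: "\<not> A \<subseteq> {1..psum u n}" using * by auto
    then have "{1..psum u n} \<subseteq> A" using A(1) unfolding compat_def by blast
    then have "j \<in> A" using * by auto
    moreover have "psize (l j) \<noteq> 0" if st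
    proof -
      have "{1..psum u n} \<subseteq> support l" using A(2) that n unfolding below_def by blast
      then show ?thesis using * by (auto simp: support_def)
    qed
    moreover have "psize (l k) \<le> psize (l j)" "st \<Longrightarrow> psize (l k) \<noteq> 0 \<Longrightarrow> psize (l k) < psize (l j)"
      using lD(3)[of j n k] lD(4)[of j n k] * by auto
    ultimately show ?thesis
      using True by (cases "psize (l k) = 0") (auto simp: psz)
  qed (simp add: psz)
  ultimately show "raise A b l \<in> block_seqs u ov st" by (auto simp: block_seqs_def)
  show "lower (raise A b l) = l"
  proof
    fix j
    have "\<not> overlined (l j) \<or> 1 \<le> psize (l j)" using ps by (auto simp: Suc_le_eq)
    moreover have "b \<Longrightarrow> psize (l d) = 0" using d by (auto simp: support_def)
    moreover have "j \<in> A \<or> l j = Plain 0" using outside by blast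
    ultimately show "lower (raise A b l) j = l j"
      unfolding part_eq_iff lower_def psize_mk_part overlined_mk_part psz ovl by auto
  qed
  show "(\<exists>j. raise A b l j = Over 1) \<longleftrightarrow> b"
  proof
    assume "\<exists>j. raise A b l j = Over 1"
    then obtain j where j: "overlined (raise A b l j)" "psize (raise A b l j) = 1"
      by (metis overlined.simps(2) psize.simps(2))
    then have "psize (l j) = 0" by (auto simp: psz split: if_splits)
    then have "\<not> overlined (l j)" using ps by auto
    then show b using j ovl by blast
  next
    assume b
    then have "raise A b l d = Over 1"
      unfolding part_eq_iff psz ovl using d by (simp add: support_def)
    then show "\<exists>j. raise A b l j = Over 1" by blast
  qed
qed

lemma weight_lower:
  assumes "l \<in> part_seqs" "lower l \<in> part_seqs"
  shows "weight l = card (support l) + weight (lower l)"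
proof -
  have "support (lower l) \<subseteq> support l" by (auto simp: support_def lower_def)
  then have "weight (lower l) = (\<Sum>i\<in>support l. psize (lower l i))"
    unfolding weight_eq_sum_support[OF assms(2)]
    using part_seqs_support[OF assms(1)] by (intro sum.mono_neutral_left) (auto simp: support_def)
  moreover have "(\<Sum>i\<in>support l. psize (l i)) = (\<Sum>i\<in>support l. 1 + psize (lower l i))"
    by (rule sum.cong) (auto simp: support_def lower_def)
  ultimately show ?thesis
    by (simp add: weight_eq_sum_support[OF assms(1)] sum_Suc)
qed

lemma color_weight_lower:
  assumes "l \<in> part_seqs" "lower l \<in> part_seqs" "support l \<noteq> {}"
  shows "color_weight l = color (mk_part (card (support l)) (\<exists>j. l j = Over 1)) * color_weight (lower l)"
proof -
  define I where "I = (\<lambda>l :: nat \<Rightarrow> part. {i. i \<ge> 1 \<and> (\<exists>j. i \<le> psize (l j))})"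
  define t where "t = (\<lambda>(l :: nat \<Rightarrow> part) i. color (mk_part (card {j. i \<le> psize (l j)}) (\<exists>j. l j = Over i)))"
  have "I (lower l) \<subseteq> (\<Union>j\<in>support (lower l). {..psize (lower l j)})"
  proof
    fix i assume "i \<in> I (lower l)"
    then obtain j where "i \<ge> 1" "i \<le> psize (lower l j)" by (auto simp: I_def)
    then have "j \<in> support (lower l)" "i \<in> {..psize (lower l j)}" by (auto simp: support_def)
    then show "i \<in> (\<Union>j\<in>support (lower l). {..psize (lower l j)})" by blast
  qed
  then have fin: "finite (I (lower l))"
    using part_seqs_support(1)[OF assms(2)] finite_subset by blast
  have I: "I l = insert 1 (Suc ` I (lower l))"
  proof (intro set_eqI)
    fix i
    obtain j where j: "1 \<le> psize (l j)" using assms(3) by (auto simp: support_def Suc_le_eq)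
    show "i \<in> I l \<longleftrightarrow> i \<in> insert 1 (Suc ` I (lower l))"
    proof (cases "i \<le> 1")
      case True
      then show ?thesis using j by (cases i) (auto simp: I_def)
    next
      case False
      then obtain k where "i = Suc k" "k \<ge> 1" by (cases i) auto
      moreover have "Suc k \<le> psize (l j) \<longleftrightarrow> k \<le> psize (lower l j)" if "k \<ge> 1" for j
        using that by (auto simp: lower_def)
      ultimately show ?thesis by (auto simp: I_def)
    qed
  qed
  have "t l 1 = color (mk_part (card (support l)) (\<exists>j. l j = Over 1))"
    by (simp add: t_def support_def Suc_le_eq)
  moreover have "t l (Suc i) = t (lower l) i" if "i \<in> I (lower l)" for i
  proof -
    have i: "i \<ge> 1" using that by (simp add: I_def)
    have "Suc i \<le> psize (l j) \<longleftrightarrow> i \<le> psize (lower l j)" for j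
      using i by (auto simp: lower_def)
    moreover have "l j = Over (Suc i) \<longleftrightarrow> lower l j = Over i" for j
      using i by (auto simp: lower_def part_eq_iff)
    ultimately show ?thesis by (simp add: t_def)
  qed
  moreover have "1 \<notin> Suc ` I (lower l)" by (auto simp: I_def)
  ultimately have "prod (t l) (I l) = color (mk_part (card (support l)) (\<exists>j. l j = Over 1)) * prod (t (lower l)) (I (lower l))"
    unfolding I using fin by (simp add: prod.reindex)
  then show ?thesis
    by (simp add: color_weight_eq_prod[OF assms(1)] color_weight_eq_prod[OF assms(2)] I_def t_def)
qed

section \<open>Generating functions by largest level set\<close>

unbundle no vec_syntax
unbundle fps_syntax

definition block_gf :: "(nat \<Rightarrow> nat) \<Rightarrow> bool \<Rightarrow> bool \<Rightarrow> nat set \<Rightarrow> color_poly fps" where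
  "block_gf u ov st A = Abs_fps (\<lambda>N. \<Sum>l | l \<in> block_seqs u ov st \<and> support l = A \<and> weight l = N. color_weight l)"

lemma finite_part_seqs_weight:
  assumes "finite A"
  shows "finite {l \<in> part_seqs. support l = A \<and> weight l = N}"
proof (rule finite_subset)
  let ?P = "Plain ` {..N} \<union> Over ` {..N}"
  show "finite {f. \<forall>x. (x \<in> A \<longrightarrow> f x \<in> ?P) \<and> (x \<notin> A \<longrightarrow> f x = Plain 0)}"
    using assms by (intro finite_set_of_finite_funs) auto
  show "{l \<in> part_seqs. support l = A \<and> weight l = N}
    \<subseteq> {f. \<forall>x. (x \<in> A \<longrightarrow> f x \<in> ?P) \<and> (x \<notin> A \<longrightarrow> f x = Plain 0)}"
  proof safe
    fix l x assume l: "l \<in> part_seqs"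
    show "l x = Plain 0" if "x \<notin> support l"
      using that l by (auto simp: mem_part_seqs_iff support_def part_eq_iff)
    assume x: "x \<in> support l" "l x \<notin> Over ` {..weight l}"
    have "psize (l x) \<le> weight l"
      unfolding weight_eq_sum_support[OF l] using x part_seqs_support[OF l] by (intro member_le_sum) auto
    then show "l x \<in> Plain ` {..weight l}" using x by (cases "l x") auto
  qed
qed

lemma block_gf_sum_nth:
  assumes "finite \<B>" "\<forall>B\<in>\<B>. finite B"
  shows "(\<Sum>B\<in>\<B>. block_gf u ov st B) $ N
    = (\<Sum>l | l \<in> block_seqs u ov st \<and> support l \<in> \<B> \<and> weight l = N. color_weight l)"
    and "finite {l. l \<in> block_seqs u ov st \<and> support l \<in> \<B> \<and> weight l = N}"
proof -
  let ?S = "{l. l \<in> block_seqs u ov st \<and> support l \<in> \<B> \<and> weight l = N}"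
  have "?S \<subseteq> (\<Union>B\<in>\<B>. {l \<in> part_seqs. support l = B \<and> weight l = N})"
    by (auto simp: block_seqs_def)
  then show fin: "finite ?S"
    using assms finite_part_seqs_weight by (meson finite_UN finite_subset)
  have "(\<Sum>B\<in>\<B>. block_gf u ov st B) $ N = (\<Sum>B\<in>\<B>. \<Sum>l\<in>{l \<in> ?S. support l = B}. color_weight l)"
    unfolding fps_sum_nth block_gf_def fps_nth_Abs_fps
    by (intro sum.cong refl) (auto intro!: sum.cong)
  also have "\<dots> = sum color_weight ?S"
    using fin assms(1) by (intro sum.group) auto
  finally show "(\<Sum>B\<in>\<B>. block_gf u ov st B) $ N = sum color_weight ?S" .
qed

lemma block_gf_empty: "block_gf u ov st {} = 1"
proof (rule fps_ext)
  fix N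
  have "l = (\<lambda>_. Plain 0)" if "l \<in> part_seqs" "support l = {}" for l
    using that by (auto simp: mem_part_seqs_iff support_def part_eq_iff)
  moreover have 0: "(\<lambda>_. Plain 0) \<in> block_seqs u ov st"
    by (auto simp: block_seqs_def mem_part_seqs_iff)
  moreover have w: "weight (\<lambda>_. Plain 0) = 0" by (simp add: weight_def)
  moreover have "support (\<lambda>_. Plain 0) = {}" by (simp add: support_def)
  ultimately have "l \<in> block_seqs u ov st \<and> support l = {} \<and> weight l = N \<longleftrightarrow> l = (\<lambda>_. Plain 0) \<and> N = 0" for l
    using block_seqsD(1) by metis
  then have "{l. l \<in> block_seqs u ov st \<and> support l = {} \<and> weight l = N}
    = (if N = 0 then {\<lambda>_. Plain 0} else {})"
    by auto
  moreover have "color_weight (\<lambda>_. Plain 0) = 1"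
    using block_seqsD(1)[OF 0] by (auto simp: color_weight_eq_prod intro!: prod.neutral)
  ultimately show "block_gf u ov st {} $ N = 1 $ N"
    by (simp add: block_gf_def)
qed

definition color_q :: "bool \<Rightarrow> nat \<Rightarrow> color_poly fps" where
  "color_q ov k = fps_const (color (mk_part k ov)) * fps_X ^ k"

lemma color_q_mult_nth: "(color_q ov k * f) $ N = (if N < k then 0 else color (mk_part k ov) * f $ (N - k))"
  by (simp add: color_q_def mult.assoc fps_X_power_mult_nth)

lemma block_gf_rec:
  assumes A: "compat u A" "A \<noteq> {}"
  shows "block_gf u ov st A = color_q False (card A) * (\<Sum>B | below u st A B. block_gf u ov st B)
    + of_bool ov * color_q True (card A) * (\<Sum>B | below u st A B \<and> B \<noteq> A. block_gf u ov st B)"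
proof (rule fps_ext)
  fix N
  define s where "s = card A"
  have finA: "finite A" using A by (simp add: compat_def)
  define T where "T = (\<lambda>b. {l \<in> block_seqs u ov st. below u st A (support l)
      \<and> (b \<longrightarrow> ov \<and> support l \<noteq> A) \<and> s + weight l = N})"
  let ?S = "{l. l \<in> block_seqs u ov st \<and> support l = A \<and> weight l = N}"
  have low: "finite {B. below u st A B \<and> Q B}" "\<forall>B\<in>{B. below u st A B \<and> Q B}. finite B" for Q
  proof -
    show "finite {B. below u st A B \<and> Q B}"
      by (rule finite_subset[of _ "Pow A"]) (use finA in \<open>auto simp: below_def\<close>)
  qed (auto simp: below_def compat_def)
  have coeff: "(color_q b s * (\<Sum>B | below u st A B \<and> (b \<longrightarrow> ov \<and> B \<noteq> A). block_gf u ov st B)) $ N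
      = (\<Sum>l\<in>T b. color (mk_part s b) * color_weight l)" and finT: "finite (T b)" for b
  proof -
    let ?Q = "\<lambda>B. b \<longrightarrow> ov \<and> B \<noteq> A"
    let ?B = "{B. below u st A B \<and> ?Q B}"
    note sums = block_gf_sum_nth[OF low(1)[of ?Q] low(2)[of ?Q]]
    have T: "T b = (if N < s then {} else
        {l. l \<in> block_seqs u ov st \<and> support l \<in> ?B \<and> weight l = N - s})"
      by (auto simp: T_def)
    show "finite (T b)" unfolding T using sums(2) by simp
    show "(color_q b s * (\<Sum>B | below u st A B \<and> (b \<longrightarrow> ov \<and> B \<noteq> A). block_gf u ov st B)) $ N
      = (\<Sum>l\<in>T b. color (mk_part s b) * color_weight l)"
      unfolding color_q_mult_nth T sums(1) by (simp add: sum_distrib_left)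
  qed
  have "block_gf u ov st A $ N = sum color_weight ?S"
    by (simp add: block_gf_def)
  also have "\<dots> = (\<Sum>(b, l)\<in>(SIGMA b:UNIV. T b). color (mk_part s b) * color_weight l)"
  proof (rule sum.reindex_bij_witness[where i = "\<lambda>(b, l). raise A b l" and j = "\<lambda>l. (\<exists>j. l j = Over 1, lower l)"])
    fix l assume l: "l \<in> ?S"
    then have lb: "l \<in> block_seqs u ov st" and sl: "support l = A" and wl: "weight l = N" by auto
    note ps = block_seqsD(1)[OF lb] block_seqsD(1)[OF lower_block_seqs[OF lb]]
    show "(case (\<exists>j. l j = Over 1, lower l) of (b, l) \<Rightarrow> raise A b l) = l"
      using raise_lower[OF ps(1)] sl by simp
    have "ov \<and> support (lower l) \<noteq> A" if "l j = Over 1" for j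
    proof
      show ov using block_seqsD(2)[OF lb, of j] that by simp
      have "j \<in> A" using that sl by (auto simp: support_def)
      moreover have "j \<notin> support (lower l)" using that by (simp add: support_def lower_def)
      ultimately show "support (lower l) \<noteq> A" by blast
    qed
    moreover have "s + weight (lower l) = N" using weight_lower[OF ps] sl wl s_def by simp
    ultimately have "lower l \<in> T (\<exists>j. l j = Over 1)"
      using lower_block_seqs[OF lb] below_support_lower[OF lb] sl by (auto simp: T_def)
    then show "(\<exists>j. l j = Over 1, lower l) \<in> (SIGMA b:UNIV. T b)" by simp
    show "(case (\<exists>j. l j = Over 1, lower l) of (b, l) \<Rightarrow> color (mk_part s b) * color_weight l) = color_weight l"
      using color_weight_lower[OF ps] sl A(2) by (simp add: s_def)
  next
    fix p assume p: "p \<in> (SIGMA b:UNIV. T b)"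
    obtain b l where [simp]: "p = (b, l)" by (cases p)
    have l: "l \<in> block_seqs u ov st" "below u st A (support l)" "s + weight l = N"
      and b: "b \<Longrightarrow> ov \<and> support l \<noteq> A"
      using p by (auto simp: T_def)
    note r = raise_block_seqs_inverse[OF l(1) A(1) l(2) b]
    show "(\<lambda>l. (\<exists>j. l j = Over 1, lower l)) (case p of (b, l) \<Rightarrow> raise A b l) = p"
      using r by simp
    have "weight (raise A b l) = N"
      using weight_lower[OF block_seqsD(1)[OF r(1)]] r(2) block_seqsD(1)[OF l(1)] l(3) by (simp add: s_def)
    then show "(case p of (b, l) \<Rightarrow> raise A b l) \<in> ?S"
      using r(1) by simp
  qed
  also have "\<dots> = (\<Sum>b\<in>UNIV. \<Sum>l\<in>T b. color (mk_part s b) * color_weight l)"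
    using finT by (subst sum.Sigma) auto
  also have "\<dots> = (\<Sum>b\<in>UNIV. (color_q b s * (\<Sum>B | below u st A B \<and> (b \<longrightarrow> ov \<and> B \<noteq> A). block_gf u ov st B)) $ N)"
    by (simp only: coeff)
  also have "\<dots> = (color_q False s * (\<Sum>B | below u st A B. block_gf u ov st B)
    + of_bool ov * color_q True s * (\<Sum>B | below u st A B \<and> B \<noteq> A. block_gf u ov st B)) $ N"
    by (cases ov) (simp_all add: UNIV_bool add.commute)
  finally show "block_gf u ov st A $ N = (color_q False (card A) * (\<Sum>B | below u st A B. block_gf u ov st B)
    + of_bool ov * color_q True (card A) * (\<Sum>B | below u st A B \<and> B \<noteq> A. block_gf u ov st B)) $ N"
    by (simp add: s_def)
qed

lemma color_q_geometric:
  assumes "k \<ge> 1"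
  shows "(1 - color_q False k) * fps_right_inverse (1 - color_q False k) 1 = 1"
  using assms by (intro fps_right_inverse) (simp add: color_q_def)

lemma solve_geometric:
  fixes g :: "'a::comm_ring_1"
  assumes "(1 - z) * r = 1" "g = z * (g + s) + y * s"
  shows "g = (z + y) * r * s"
proof -
  have "g = (1 - z) * r * g" using assms(1) by simp
  also have "\<dots> = r * (g - z * g)" by (simp add: algebra_simps)
  also have "g - z * g = z * (g + s) + y * s - z * g" using assms(2) by (rule arg_cong)
  also have "r * \<dots> = (z + y) * r * s" by (simp add: algebra_simps)
  finally show ?thesis .
qed

lemma psum_Suc [simp]: "psum u (Suc n) = psum u n + u (Suc n)" and psum_0 [simp]: "psum u 0 = 0"
  by (simp_all add: psum_def)

lemma psum_mono: "m \<le> n \<Longrightarrow> psum u m \<le> psum u n"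
  by (rule lift_Suc_mono_le) simp_all

lemma block_Suc: "block u (Suc n) = {psum u n + 1..psum u n + u (Suc n)}"
  by (simp add: block_def)

lemma compat_prefix_Un:
  assumes "T \<subseteq> block u (Suc n)"
  shows "compat u ({1..psum u n} \<union> T)"
  unfolding compat_def
proof (intro conjI allI)
  show "finite ({1..psum u n} \<union> T)" "0 \<notin> {1..psum u n} \<union> T"
    using assms finite_subset[of T] by (auto simp: block_Suc)
  fix m
  show "{1..psum u n} \<union> T \<subseteq> {1..psum u m} \<or> {1..psum u m} \<subseteq> {1..psum u n} \<union> T"
  proof (cases "m \<le> n")
    case True
    then show ?thesis using psum_mono[of m n u] by auto
  next
    case False
    then have "psum u (Suc n) \<le> psum u m" by (intro psum_mono) simp
    then show ?thesis using assms by (auto simp: block_Suc subset_iff)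
  qed
qed

definition cut_gf :: "(nat \<Rightarrow> nat) \<Rightarrow> bool \<Rightarrow> bool \<Rightarrow> nat \<Rightarrow> color_poly fps" where
  "cut_gf u ov st n = (if st then block_gf u ov st {1..psum u n}
     else \<Sum>B | B \<subseteq> {1..psum u n} \<and> compat u B. block_gf u ov st B)"

definition level_weight :: "bool \<Rightarrow> nat \<Rightarrow> color_poly fps" where
  "level_weight ov k = (color_q False k + of_bool ov * color_q True k)
     * fps_right_inverse (1 - color_q False k) 1"

lemma below_prefix_Un:
  assumes T: "T \<subseteq> block u (Suc n)" "T \<noteq> {}"
  shows "{B. below u st ({1..psum u n} \<union> T) B} = (\<lambda>T'. {1..psum u n} \<union> T') ` {T'. T' \<subseteq> T \<and> T' \<noteq> {}}
      \<union> (if st then {{1..psum u n}} else {B. B \<subseteq> {1..psum u n} \<and> compat u B})"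
proof -
  let ?V = "{1..psum u n}"
  have disj: "?V \<inter> T = {}" using T by (auto simp: block_Suc)
  have nsub: "\<not> ?V \<union> T' \<subseteq> ?V" if "T' \<subseteq> T" "T' \<noteq> {}" for T' using that disj by blast
  have compV: "compat u ?V" using compat_prefix_Un[of "{}" u n] by simp
  have below_V: "below u st (?V \<union> T) (?V \<union> T')" if "T' \<subseteq> T" for T'
  proof -
    have "?V \<union> T \<subseteq> {1..psum u m} \<or> {1..psum u m} \<subseteq> ?V \<union> T'" for m
    proof (cases "m \<le> n")
      case True
      then show ?thesis using psum_mono[of m n u] by auto
    next
      case False
      then have "psum u (Suc n) \<le> psum u m" by (intro psum_mono) simp
      then show ?thesis using T by (auto simp: block_Suc subset_iff)
    qed
    moreover have "compat u (?V \<union> T')"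
      using that T by (intro compat_prefix_Un) auto
    ultimately show ?thesis using that unfolding below_def by blast
  qed
  show ?thesis (is "?L = ?R")
  proof
    show "?L \<subseteq> ?R"
    proof
      fix B assume "B \<in> ?L"
      then have B: "B \<subseteq> ?V \<union> T" "compat u B" "st \<Longrightarrow> ?V \<subseteq> B"
        using nsub[OF order_refl T(2)] unfolding below_def by blast+
      show "B \<in> ?R"
      proof (cases "?V \<subseteq> B \<and> B \<inter> T \<noteq> {}")
        case True
        then have "B = ?V \<union> (B \<inter> T)" using B by blast
        then show ?thesis using True by blast
      next
        case False
        have "B \<subseteq> ?V \<or> ?V \<subseteq> B" using B(2) unfolding compat_def by blast
        then have "B \<subseteq> ?V" using False B by blast
        then show ?thesis using B by auto
      qed
    qed
    show "?R \<subseteq> ?L"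
    proof
      fix B assume "B \<in> ?R"
      then consider T' where "T' \<subseteq> T" "B = ?V \<union> T'" | "B = ?V" | "\<not> st" "B \<subseteq> ?V" "compat u B"
        by (auto split: if_splits)
      then show "B \<in> ?L"
      proof cases
        case 1
        then show ?thesis using below_V by simp
      next
        case 2
        then show ?thesis using below_V[of "{}"] by simp
      next
        case 3
        then show ?thesis by (auto simp: below_def)
      qed
    qed
  qed
qed

lemma block_gf_prefix_Un:
  assumes "T \<subseteq> block u (Suc n)" "T \<noteq> {}"
  shows "block_gf u ov st ({1..psum u n} \<union> T) = level_weight ov (psum u n + card T)
      * asc_sum (\<lambda>i. level_weight ov (psum u n + i)) T * cut_gf u ov st n" (is "?g T = ?f T * _")
    and "(\<Sum>B | below u st ({1..psum u n} \<union> T) B \<and> B \<noteq> {1..psum u n} \<union> T. block_gf u ov st B)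
      = asc_sum (\<lambda>i. level_weight ov (psum u n + i)) T * cut_gf u ov st n" (is "?s T = ?a T * _")
proof -
  let ?V = "{1..psum u n}"
  have fin: "finite T" using assms finite_subset by (auto simp: block_def)
  then have "?g T = ?f T * cut_gf u ov st n \<and> ?s T = ?a T * cut_gf u ov st n"
    using assms
  proof (induction T rule: finite_psubset_induct)
    case (psubset T)
    define A where "A = ?V \<union> T"
    have disj: "?V \<inter> T = {}" using psubset.prems by (auto simp: block_Suc)
    have IH: "?g T' = ?f T' * cut_gf u ov st n" if "T' \<subset> T" "T' \<noteq> {}" for T'
      using psubset.IH[OF that(1)] that psubset.prems by auto
    let ?L = "if st then {?V} else {B. B \<subseteq> ?V \<and> compat u B}"
    have "{B. below u st A B \<and> B \<noteq> A} = (\<lambda>T'. ?V \<union> T') ` {T'. T' \<subset> T \<and> T' \<noteq> {}} \<union> ?L"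
    proof -
      have "{B. below u st A B \<and> B \<noteq> A} = {B. below u st A B} - {A}" by blast
      also have "\<dots> = ((\<lambda>T'. ?V \<union> T') ` {T'. T' \<subseteq> T \<and> T' \<noteq> {}} - {A}) \<union> (?L - {A})"
        unfolding A_def below_prefix_Un[OF psubset.prems] by blast
      also have "?L - {A} = ?L"
      proof -
        have "\<not> A \<subseteq> ?V" using psubset.prems(2) disj A_def by blast
        then show ?thesis by auto
      qed
      also have "(\<lambda>T'. ?V \<union> T') ` {T'. T' \<subseteq> T \<and> T' \<noteq> {}} - {A} = (\<lambda>T'. ?V \<union> T') ` {T'. T' \<subset> T \<and> T' \<noteq> {}}"
        using disj unfolding A_def by blast
      finally show ?thesis .
    qed
    moreover have "(\<lambda>T'. ?V \<union> T') ` {T'. T' \<subset> T \<and> T' \<noteq> {}} \<inter> ?L = {}"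
      using disj by (auto split: if_splits)
    moreover have "inj_on (\<lambda>T'. ?V \<union> T') {T'. T' \<subset> T \<and> T' \<noteq> {}}"
      using disj by (intro inj_onI) blast
    moreover have "finite {T'. T' \<subset> T \<and> T' \<noteq> {}}"
      by (rule finite_subset[of _ "Pow T"]) (use psubset.hyps in auto)
    moreover have "finite ?L" by simp
    ultimately have "?s T = (\<Sum>T' | T' \<subset> T \<and> T' \<noteq> {}. ?g T') + sum (block_gf u ov st) ?L"
      unfolding A_def[symmetric] by (simp only: sum.union_disjoint finite_imageI sum.reindex o_def)
    also have "sum (block_gf u ov st) ?L = cut_gf u ov st n" by (simp add: cut_gf_def)
    also have "(\<Sum>T' | T' \<subset> T \<and> T' \<noteq> {}. ?g T') = (\<Sum>T' | T' \<subset> T \<and> T' \<noteq> {}. ?f T' * cut_gf u ov st n)"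
      by (intro sum.cong IH) auto
    also have "\<dots> + cut_gf u ov st n = ?a T * cut_gf u ov st n"
      unfolding asc_sum_rec[OF psubset.hyps psubset.prems(2)] sum_distrib_right[symmetric]
      by (simp add: algebra_simps)
    finally have s: "?s T = ?a T * cut_gf u ov st n" .
    have "card A = psum u n + card T"
      unfolding A_def using disj psubset.hyps by (subst card_Un_disjoint) auto
    moreover have "compat u A" unfolding A_def using psubset.prems(1) by (rule compat_prefix_Un)
    moreover have "A \<noteq> {}" unfolding A_def using psubset.prems(2) by blast
    moreover have "(\<Sum>B | below u st A B. block_gf u ov st B) = block_gf u ov st A + ?s T"
    proof -
      have "finite {B. below u st A B}"
        by (rule finite_subset[of _ "Pow A"]) (use psubset.hyps in \<open>auto simp: below_def A_def\<close>)
      moreover have "A \<in> {B. below u st A B}"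
        unfolding A_def using below_prefix_Un[OF psubset.prems, of st] psubset.prems(2) by blast
      moreover have "{B. below u st A B} - {A} = {B. below u st A B \<and> B \<noteq> A}" by blast
      ultimately show ?thesis unfolding A_def[symmetric] by (simp add: sum.remove)
    qed
    ultimately have rec: "?g T = color_q False (psum u n + card T) * (?g T + ?s T)
        + of_bool ov * color_q True (psum u n + card T) * ?s T"
      using block_gf_rec[of u A ov st] unfolding A_def[symmetric] by simp
    have "card T \<ge> 1" using psubset.hyps psubset.prems(2) by (simp add: Suc_le_eq card_gt_0_iff)
    define z where "z = color_q False (psum u n + card T)"
    define y where "y = of_bool ov * color_q True (psum u n + card T)"
    define r where "r = fps_right_inverse (1 - z) 1"
    have r: "(1 - z) * r = 1"
      unfolding z_def r_def using \<open>card T \<ge> 1\<close> by (intro color_q_geometric) simp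
    have "?g T = (z + y) * r * ?s T"
      using rec unfolding z_def[symmetric] y_def[symmetric] by (rule solve_geometric[OF r])
    then have "?g T = level_weight ov (psum u n + card T) * ?s T"
      by (simp add: level_weight_def z_def y_def r_def)
    with s show ?case by (simp add: mult.assoc)
  qed
  then show "?g T = ?f T * cut_gf u ov st n" "?s T = ?a T * cut_gf u ov st n" by blast+
qed

section \<open>Infinite sums and products\<close>

abbreviation prefix_sum :: "(nat \<Rightarrow> nat) \<Rightarrow> bool \<Rightarrow> bool \<Rightarrow> nat \<Rightarrow> color_poly fps" where
  "prefix_sum u ov st n \<equiv> (\<Sum>B | B \<subset> {1..psum u n} \<and> compat u B. block_gf u ov st B)"

abbreviation block_asc_sum :: "(nat \<Rightarrow> nat) \<Rightarrow> bool \<Rightarrow> nat \<Rightarrow> color_poly fps" where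
  "block_asc_sum u ov n \<equiv> asc_sum (\<lambda>i. level_weight ov (psum u n + i)) (block u (Suc n))"

lemma Max_image_le_Min_image_iff:
  fixes f :: "'a \<Rightarrow> 'b::linorder"
  assumes "finite X" "X \<noteq> {}" "finite Y" "Y \<noteq> {}"
  shows "Max (f ` X) \<le> Min (f ` Y) \<longleftrightarrow> (\<forall>j\<in>Y. \<forall>k\<in>X. f k \<le> f j)"
  using assms by (simp add: Max_le_iff Min_ge_iff)

lemma all_ge_1_iff: "(\<forall>n\<ge>1. P n) \<longleftrightarrow> (\<forall>n. P (Suc n))"
  by (metis One_nat_def Suc_le_D Suc_le_mono le0)

context
  fixes u :: "nat \<Rightarrow> nat"
  assumes u_pos: "\<forall>n\<ge>1. u n > 0"
begin

lemma le_psum: "n \<le> psum u n"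
proof (induction n)
  case (Suc n)
  then show ?case using u_pos[rule_format, of "Suc n"] by simp
qed simp

lemma prefix_Suc: "{1..psum u n} \<union> block u (Suc n) = {1..psum u (Suc n)}"
  by (auto simp: block_Suc)

lemma block_nonempty: "block u (Suc n) \<noteq> {}"
  using u_pos[rule_format, of "Suc n"] by (simp add: block_Suc)

lemma card_block: "psum u n + card (block u (Suc n)) = psum u (Suc n)"
  by (simp add: block_Suc)

lemmas block_gf_prefix_Suc =
  block_gf_prefix_Un[OF order_refl block_nonempty, where n = n, unfolded prefix_Suc card_block] for n

lemma cut_gf_0: "cut_gf u ov st 0 = 1"
proof -
  have "{B. B = {} \<and> compat u B} = {{}}" by (auto simp: compat_def)
  then show ?thesis by (simp add: cut_gf_def block_gf_empty)
qed

lemma cut_gf_Suc_lax: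
  "cut_gf u ov False (Suc n) = cut_gf u ov False n * ((1 + level_weight ov (psum u (Suc n))) * block_asc_sum u ov n)"
proof -
  let ?V = "{1..psum u (Suc n)}"
  have "compat u ?V" using compat_prefix_Un[of "{}" u "Suc n"] by simp
  then have "{B. B \<subseteq> ?V \<and> compat u B} = insert ?V {B. below u False ?V B \<and> B \<noteq> ?V}"
    by (auto simp: below_def)
  moreover have "finite {B. below u False ?V B \<and> B \<noteq> ?V}"
    by (rule finite_subset[of _ "Pow ?V"]) (auto simp: below_def)
  ultimately have "cut_gf u ov False (Suc n)
      = block_gf u ov False ?V + (\<Sum>B | below u False ?V B \<and> B \<noteq> ?V. block_gf u ov False B)"
    by (simp add: cut_gf_def)
  then show ?thesis
    unfolding block_gf_prefix_Suc by (simp add: algebra_simps)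
qed

lemma cut_gf_Suc_strict:
  "cut_gf u ov True (Suc n) = cut_gf u ov True n * (level_weight ov (psum u (Suc n)) * block_asc_sum u ov n)"
  using block_gf_prefix_Suc(1)[of ov True n] by (simp add: cut_gf_def algebra_simps)

lemma prefix_sum_Suc:
  "prefix_sum u ov True (Suc n) = prefix_sum u ov True n + block_asc_sum u ov n * cut_gf u ov True n"
proof -
  let ?V = "{1..psum u n}" and ?W = "{1..psum u (Suc n)}"
  have VW: "?V \<subset> ?W" using block_nonempty[of n] by (auto simp: block_Suc)
  have "{B. B \<subset> ?W \<and> compat u B} = {B. B \<subset> ?V \<and> compat u B} \<union> {B. below u True ?W B \<and> B \<noteq> ?W}"
  proof (intro set_eqI iffI)
    fix B assume B: "B \<in> {B. B \<subset> ?W \<and> compat u B}"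
    show "B \<in> {B. B \<subset> ?V \<and> compat u B} \<union> {B. below u True ?W B \<and> B \<noteq> ?W}"
    proof (cases "?V \<subseteq> B")
      case True
      have "?W \<subseteq> {1..psum u m} \<or> {1..psum u m} \<subseteq> B" for m
      proof (cases "m \<le> n")
        case m: True
        then have "{1..psum u m} \<subseteq> ?V" using psum_mono[of m n u] by auto
        then show ?thesis using True by blast
      next
        case False
        then have "psum u (Suc n) \<le> psum u m" by (intro psum_mono) simp
        then show ?thesis by auto
      qed
      then show ?thesis using B unfolding below_def by blast
    next
      case False
      then have "B \<subset> ?V" using B unfolding compat_def by blast
      then show ?thesis using B by blast
    qed
  next
    fix B assume "B \<in> {B. B \<subset> ?V \<and> compat u B} \<union> {B. below u True ?W B \<and> B \<noteq> ?W}"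
    then show "B \<in> {B. B \<subset> ?W \<and> compat u B}" using VW unfolding below_def by blast
  qed
  moreover have "{B. B \<subset> ?V \<and> compat u B} \<inter> {B. below u True ?W B \<and> B \<noteq> ?W} = {}"
    using VW unfolding below_def by blast
  moreover have "finite {B. B \<subset> ?V \<and> compat u B}"
    by (rule finite_subset[of _ "Pow ?V"]) auto
  moreover have "finite {B. below u True ?W B \<and> B \<noteq> ?W}"
    by (rule finite_subset[of _ "Pow ?W"]) (auto simp: below_def)
  ultimately have "prefix_sum u ov True (Suc n)
      = prefix_sum u ov True n + (\<Sum>B | below u True ?W B \<and> B \<noteq> ?W. block_gf u ov True B)"
    by (simp only: sum.union_disjoint)
  then show ?thesis unfolding block_gf_prefix_Suc by simp
qed

lemma support_subset_prefix:
  assumes "l \<in> block_seqs u ov st"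
  shows "support l \<subset> {1..psum u (Suc (weight l))}" "support l \<subseteq> {1..psum u (weight l)}"
proof -
  note ps = block_seqsD(1)[OF assms]
  have "card (support l) = (\<Sum>i\<in>support l. 1)" by simp
  also have "\<dots> \<le> weight l"
    unfolding weight_eq_sum_support[OF ps] by (rule sum_mono) (simp add: support_def Suc_le_eq)
  finally have c: "card (support l) \<le> weight l" .
  have compat: "support l \<subseteq> {1..psum u n} \<or> {1..psum u n} \<subseteq> support l" "finite (support l)" for n
    using compat_support[OF assms] unfolding compat_def by blast+
  have "support l \<subseteq> {1..psum u n}" if "weight l \<le> n" for n
  proof (rule ccontr)
    assume "\<not> support l \<subseteq> {1..psum u n}"
    then have "{1..psum u n} \<subset> support l" using compat(1)[of n] by blast
    then have "card {1..psum u n} < card (support l)" using compat(2) by (rule psubset_card_mono[rotated])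
    then show False using c le_psum[of n] that by simp
  qed
  moreover have "support l \<noteq> {1..psum u (Suc (weight l))}"
    using c le_psum[of "Suc (weight l)"] by auto
  ultimately show "support l \<subset> {1..psum u (Suc (weight l))}" "support l \<subseteq> {1..psum u (weight l)}"
    using le_SucI[OF order_refl] by blast+
qed

definition total_gf :: "bool \<Rightarrow> bool \<Rightarrow> color_poly fps" where
  "total_gf ov st = Abs_fps (\<lambda>N. \<Sum>l | l \<in> block_seqs u ov st \<and> weight l = N. color_weight l)"

lemma total_gf_nth:
  assumes "finite \<B>" "\<forall>B\<in>\<B>. finite B"
    and "\<And>l. l \<in> block_seqs u ov st \<Longrightarrow> weight l = N \<Longrightarrow> support l \<in> \<B>"
  shows "(\<Sum>B\<in>\<B>. block_gf u ov st B) $ N = total_gf ov st $ N"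
    and "finite {l. l \<in> block_seqs u ov st \<and> weight l = N}"
proof -
  have "{l. l \<in> block_seqs u ov st \<and> support l \<in> \<B> \<and> weight l = N}
      = {l. l \<in> block_seqs u ov st \<and> weight l = N}"
    using assms(3) by auto
  then show "(\<Sum>B\<in>\<B>. block_gf u ov st B) $ N = total_gf ov st $ N"
    and "finite {l. l \<in> block_seqs u ov st \<and> weight l = N}"
    using block_gf_sum_nth[OF assms(1,2), of u ov st N] by (simp_all add: total_gf_def)
qed

lemma cut_gf_nth:
  assumes "N \<le> n"
  shows "cut_gf u ov False n $ N = total_gf ov False $ N"
proof -
  have "support l \<subseteq> {1..psum u n} \<and> compat u (support l)"
    if "l \<in> block_seqs u ov False" "weight l = N" for l
  proof
    have "{1..psum u N} \<subseteq> {1..psum u n}" using psum_mono[OF assms, of u] by auto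
    then show "support l \<subseteq> {1..psum u n}" using support_subset_prefix(2)[OF that(1)] that(2) by auto
  qed (rule compat_support[OF that(1)])
  then show ?thesis
    unfolding cut_gf_def if_False by (intro total_gf_nth(1)) (auto simp: compat_def)
qed

lemma prefix_sum_nth:
  assumes "N < n"
  shows "prefix_sum u ov st n $ N = total_gf ov st $ N"
proof -
  have "support l \<subset> {1..psum u n} \<and> compat u (support l)"
    if "l \<in> block_seqs u ov st" "weight l = N" for l
  proof
    have "{1..psum u (Suc N)} \<subseteq> {1..psum u n}" using psum_mono[of "Suc N" n u] assms by auto
    then show "support l \<subset> {1..psum u n}" using support_subset_prefix(1)[OF that(1)] that(2) by auto
  qed (rule compat_support[OF that(1)])
  moreover have "finite {B. B \<subset> {1..psum u n} \<and> compat u B}"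
    by (rule finite_subset[of _ "Pow {1..psum u n}"]) auto
  ultimately show ?thesis
    by (intro total_gf_nth(1)) (auto simp: compat_def)
qed

lemma gf_term_has_sum_total_gf: "(gf_term has_sum total_gf ov st) (block_seqs u ov st)"
  unfolding has_sum_def
proof (rule tendsto_fpsI)
  fix N
  let ?X = "{l. l \<in> block_seqs u ov st \<and> weight l = N}"
  have "finite ?X"
  proof (rule total_gf_nth(2))
    show "finite (Pow {1..psum u N})" "\<forall>B\<in>Pow {1..psum u N}. finite B" by (auto intro: finite_subset)
    show "support l \<in> Pow {1..psum u N}" if "l \<in> block_seqs u ov st" "weight l = N" for l
      using support_subset_prefix(2)[OF that(1)] that(2) by simp
  qed
  moreover have "sum gf_term Y $ N = total_gf ov st $ N"
    if "finite Y" "?X \<subseteq> Y" "Y \<subseteq> block_seqs u ov st" for Y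
  proof -
    have "sum gf_term Y $ N = (\<Sum>l\<in>Y. if weight l = N then color_weight l else 0)"
      unfolding fps_sum_nth by (rule sum.cong) (auto simp: gf_term_def fps_X_power_nth)
    also have "\<dots> = sum color_weight {l \<in> Y. weight l = N}"
      using that(1) by (simp add: sum.inter_filter)
    also have "{l \<in> Y. weight l = N} = ?X" using that by blast
    finally show ?thesis by (simp add: total_gf_def)
  qed
  ultimately show "\<forall>\<^sub>F Y in finite_subsets_at_top (block_seqs u ov st). sum gf_term Y $ N = total_gf ov st $ N"
    unfolding eventually_finite_subsets_at_top by (intro exI[of _ ?X]) blast
qed

lemma cut_gf_tendsto: "(\<lambda>n. cut_gf u ov False (Suc n)) \<longlonglongrightarrow> total_gf ov False"
proof (rule tendsto_fpsI)
  fix N show "\<forall>\<^sub>F n in sequentially. cut_gf u ov False (Suc n) $ N = total_gf ov False $ N"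
    using eventually_ge_at_top[of N] by eventually_elim (simp add: cut_gf_nth)
qed

lemma prefix_sum_tendsto: "(\<lambda>n. prefix_sum u ov st n) \<longlonglongrightarrow> total_gf ov st"
proof (rule tendsto_fpsI)
  fix N show "\<forall>\<^sub>F n in sequentially. prefix_sum u ov st n $ N = total_gf ov st $ N"
    using eventually_gt_at_top[of N] by eventually_elim (rule prefix_sum_nth)
qed

lemma total_gf_lax_nonzero: "total_gf ov False \<noteq> 0"
proof
  assume "total_gf ov False = 0"
  then have "cut_gf u ov False 0 $ 0 = 0" by (simp add: cut_gf_nth)
  then show False by (simp add: cut_gf_0)
qed

lemma block_chain_le:
  fixes s :: "nat \<Rightarrow> nat"
  assumes step: "\<And>n j k. j \<in> block u (Suc n) \<Longrightarrow> k \<in> block u (Suc (Suc n)) \<Longrightarrow> s k \<le> s j"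
    and jk: "1 \<le> j" "j \<le> psum u n" "psum u n < k"
  shows "s k \<le> s j"
    and "\<lbrakk>\<And>n j k. j \<in> block u (Suc n) \<Longrightarrow> k \<in> block u (Suc (Suc n)) \<Longrightarrow> s k \<noteq> 0 \<Longrightarrow> s k < s j; s k \<noteq> 0\<rbrakk>
      \<Longrightarrow> s k < s j"
proof -
  have in_block: "\<exists>m. i \<in> block u (Suc m)" if i: "1 \<le> i" for i
  proof -
    define m where "m = (LEAST m. i \<le> psum u m)"
    have m: "i \<le> psum u m" unfolding m_def by (rule LeastI[of "\<lambda>m. i \<le> psum u m", OF le_psum])
    then obtain m' where m': "m = Suc m'" using i by (cases m) auto
    then have "\<not> i \<le> psum u m'" using not_less_Least[of m' "\<lambda>m. i \<le> psum u m"] m_def by auto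
    then show ?thesis using m m' by (intro exI[of _ m']) (auto simp: block_Suc)
  qed
  obtain a where a: "j \<in> block u (Suc a)" using in_block[OF jk(1)] by blast
  obtain b where b: "k \<in> block u (Suc b)" using in_block[of k] jk by auto
  have "a < b"
  proof (rule ccontr)
    assume "\<not> a < b"
    then have "psum u (Suc b) \<le> psum u (Suc a)" by (intro psum_mono) simp
    moreover have "psum u n \<le> psum u a \<or> psum u (Suc a) \<le> psum u n"
      using psum_mono[of n a u] psum_mono[of "Suc a" n u] by (cases "n \<le> a") auto
    ultimately show False using a b jk by (auto simp: block_Suc)
  qed
  have chain: "s k \<le> s j" if "j \<in> block u (Suc a)" "k \<in> block u (Suc (a + p) + 1)" for a p j k
    using that
  proof (induction p arbitrary: k)
    case 0
    then show ?case using step by simp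
  next
    case (Suc p)
    obtain i where i: "i \<in> block u (Suc (a + p) + 1)" using block_nonempty[of "Suc (a + p)"] by auto
    have "s k \<le> s i" using step[of i "Suc (a + p)" k] i Suc.prems by simp
    also have "s i \<le> s j" using Suc.IH[OF Suc.prems(1) i] .
    finally show ?case .
  qed
  obtain p where p: "b = Suc (a + p)" using \<open>a < b\<close> less_iff_Suc_add by auto
  show "s k \<le> s j" using chain[OF a, of k p] b p by simp
  assume st: "\<And>n j k. j \<in> block u (Suc n) \<Longrightarrow> k \<in> block u (Suc (Suc n)) \<Longrightarrow> s k \<noteq> 0 \<Longrightarrow> s k < s j"
    and k: "s k \<noteq> 0"
  show "s k < s j"
  proof (cases p)
    case 0
    then show ?thesis using st[OF a] b p k by simp
  next
    case (Suc q)
    obtain i where i: "i \<in> block u (Suc (Suc a))" using block_nonempty[of "Suc a"] by auto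
    have "s k \<le> s i" using chain[OF i, of k q] b p Suc by simp
    then show ?thesis using st[OF a i] k by linarith
  qed
qed

lemma block_order:
  assumes "j \<in> block u (Suc n)" "k \<in> block u (Suc (Suc n))"
  shows "1 \<le> j \<and> j \<le> psum u (Suc n) \<and> psum u (Suc n) < k"
  using assms by (auto simp: block_Suc)

lemma block_overpartitions_eq: "block_overpartitions u = block_seqs u True False"
proof (intro set_eqI)
  fix l
  show "l \<in> block_overpartitions u \<longleftrightarrow> l \<in> block_seqs u True False"
  proof (cases "l \<in> part_seqs")
    case True
    have le: "l k \<le> l j \<longleftrightarrow> psize (l k) \<le> psize (l j)" if "j < k" for j k
      using True that by (fastforce simp: mem_part_seqs_iff less_eq_part_def)
    have "l \<in> block_overpartitions u \<longleftrightarrow>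
        (\<forall>n. Max (l ` block u (Suc (Suc n))) \<le> Min (l ` block u (Suc n)))"
      using True all_ge_1_iff[of "\<lambda>n. Max (l ` block u (n + 1)) \<le> Min (l ` block u n)"]
      by (simp add: block_overpartitions_def)
    also have "\<dots> \<longleftrightarrow> (\<forall>n. \<forall>j\<in>block u (Suc n). \<forall>k\<in>block u (Suc (Suc n)). l k \<le> l j)"
      by (subst Max_image_le_Min_image_iff) (simp_all add: block_nonempty, simp_all add: block_def)
    also have "\<dots> \<longleftrightarrow> (\<forall>n. \<forall>j\<in>block u (Suc n). \<forall>k\<in>block u (Suc (Suc n)). psize (l k) \<le> psize (l j))"
      using le block_order by (meson le_less_trans)
    also have "\<dots> \<longleftrightarrow> (\<forall>n j k. 1 \<le> j \<and> j \<le> psum u n \<and> psum u n < k \<longrightarrow> psize (l k) \<le> psize (l j))"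
      using block_chain_le(1)[of "\<lambda>j. psize (l j)"] block_order by blast
    finally show ?thesis using True by (simp add: block_seqs_def)
  qed (auto simp: block_overpartitions_def block_seqs_def)
qed

lemma block_partitions_eq: "block_partitions u = block_seqs u False False"
proof -
  have "(\<forall>i\<ge>1. \<not> overlined (l i)) \<longleftrightarrow> (\<forall>i. \<not> overlined (l i))" if "l \<in> part_seqs" for l
  proof -
    have "\<not> overlined (l 0)" using that by (simp add: mem_part_seqs_iff)
    then show ?thesis by (metis less_one not_le)
  qed
  then show ?thesis
    unfolding block_partitions_def block_overpartitions_eq block_seqs_def by auto
qed

lemma block_overpartitions_distinct_eq: "block_overpartitions_distinct u = block_seqs u True True"
proof (intro set_eqI)
  fix l :: "nat \<Rightarrow> part"
  have psize_mono: "psize a \<le> psize b" if "a \<le> b" for a b :: part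
    using that by (auto simp: less_eq_part_def)
  have pos: "Plain 0 < a \<longleftrightarrow> psize a \<noteq> 0" for a
    by (auto simp: less_part_def)
  have fin: "finite (l ` block u n)" for n by (simp add: block_def)
  have ne: "l ` block u (Suc n) \<noteq> {}" for n using block_nonempty by simp
  define m where "m n = Min (l ` block u (Suc n))" for n
  define M where "M n = Max (l ` block u (Suc n))" for n
  have m: "m n \<in> l ` block u (Suc n)" "\<And>j. j \<in> block u (Suc n) \<Longrightarrow> psize (m n) \<le> psize (l j)" for n
    unfolding m_def using Min_in[OF fin ne] by (auto intro!: psize_mono simp: fin)
  have M: "M n \<in> l ` block u (Suc n)" "\<And>j. j \<in> block u (Suc n) \<Longrightarrow> psize (l j) \<le> psize (M n)" for n
    unfolding M_def using Max_in[OF fin ne] by (auto intro!: psize_mono simp: fin)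
  have "l \<in> block_overpartitions_distinct u \<longleftrightarrow> l \<in> block_seqs u True False
      \<and> (\<forall>n. psize (m n) \<noteq> 0 \<longrightarrow> psize (M (Suc n)) < psize (m n))"
    using all_ge_1_iff[of "\<lambda>n. psize (Min (l ` block u n)) \<noteq> 0 \<longrightarrow>
        psize (Max (l ` block u (n + 1))) < psize (Min (l ` block u n))"]
    by (simp add: block_overpartitions_distinct_def block_overpartitions_eq pos m_def M_def)
  also have "\<dots> \<longleftrightarrow> l \<in> block_seqs u True True"
  proof
    assume l: "l \<in> block_seqs u True False \<and> (\<forall>n. psize (m n) \<noteq> 0 \<longrightarrow> psize (M (Suc n)) < psize (m n))"
    note lD = block_seqsD[of l u True False, OF conjunct1[OF l]]
    have "psize (l k) < psize (l j)"
      if jk: "j \<in> block u (Suc n)" "k \<in> block u (Suc (Suc n))" "psize (l k) \<noteq> 0" for n j k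
    proof -
      obtain j0 where j0: "j0 \<in> block u (Suc n)" "m n = l j0" using m(1) by auto
      have "psize (l k) \<le> psize (m n)" using lD(3)[of j0 "Suc n" k] block_order[OF j0(1) jk(2)] j0(2) by simp
      then have "psize (M (Suc n)) < psize (m n)" using l jk by auto
      then show ?thesis using m(2)[OF jk(1)] M(2)[OF jk(2)] by linarith
    qed
    moreover have "psize (l k) \<le> psize (l j)"
      if "j \<in> block u (Suc n)" "k \<in> block u (Suc (Suc n))" for n j k
      using lD(3) block_order[OF that] by blast
    ultimately have "psize (l k) < psize (l j)"
      if "1 \<le> j" "j \<le> psum u n" "psum u n < k" "psize (l k) \<noteq> 0" for n j k
      using block_chain_le(2)[of "\<lambda>j. psize (l j)" j n k] that by blast
    then show "l \<in> block_seqs u True True"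
      using lD(1,3) unfolding block_seqs_def by blast
  next
    assume l: "l \<in> block_seqs u True True"
    have "psize (M (Suc n)) < psize (m n)" if "psize (m n) \<noteq> 0" for n
    proof -
      obtain j where j: "j \<in> block u (Suc n)" "m n = l j" using m(1) by auto
      obtain k where k: "k \<in> block u (Suc (Suc n))" "M (Suc n) = l k" using M(1) by auto
      show ?thesis
        using block_seqsD(4)[OF l, of j "Suc n" k] block_order[OF j(1) k(1)] that j k
        by (cases "psize (l k) = 0") auto
    qed
    then show "l \<in> block_seqs u True False \<and> (\<forall>n. psize (m n) \<noteq> 0 \<longrightarrow> psize (M (Suc n)) < psize (m n))"
      using l unfolding block_seqs_def by blast
  qed
  finally show "l \<in> block_overpartitions_distinct u \<longleftrightarrow> l \<in> block_seqs u True True" .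
qed

end

lemma prodinf_eq_limit:
  fixes f :: "nat \<Rightarrow> 'a::{t2_space,comm_semiring_1}"
  assumes "(\<lambda>n. \<Prod>i\<le>n. f i) \<longlonglongrightarrow> p" "p \<noteq> 0"
  shows "convergent_prod f" "prodinf f = p"
proof -
  have raw: "raw_has_prod f 0 p" using assms by (simp add: raw_has_prod_def)
  then show "convergent_prod f" unfolding convergent_prod_def by blast
  have "q = p" if "f has_prod q" for q
    using that unfolding has_prod_def
  proof
    assume "raw_has_prod f 0 q"
    then show "q = p" using assms LIMSEQ_unique by (auto simp: raw_has_prod_def)
  next
    assume "\<exists>i q'. q = 0 \<and> f i = 0 \<and> raw_has_prod f (Suc i) q'"
    then obtain i where i: "f i = 0" by blast
    have "\<forall>\<^sub>F n in sequentially. (\<Prod>i\<le>n. f i) = 0"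
      using eventually_ge_at_top[of i]
    proof eventually_elim
      fix n assume n: "i \<le> n"
      have "{..n} = insert i ({..n} - {i})" using n by auto
      then have "(\<Prod>i\<le>n. f i) = f i * prod f ({..n} - {i})"
        by (subst prod.remove[of _ i]) (use n in auto)
      then show "(\<Prod>i\<le>n. f i) = 0" using i by simp
    qed
    then have "(\<lambda>n. \<Prod>i\<le>n. f i) \<longlonglongrightarrow> 0" by (rule tendsto_eventually)
    then show "q = p" using assms LIMSEQ_unique by blast
  qed
  moreover have "f has_prod p" using raw by (simp add: has_prod_def)
  ultimately show "prodinf f = p" unfolding prodinf_def by blast
qed

lemma fps_frac_eqI:
  assumes "fps_nth g 0 = 1" "g * r = 1"
  shows "fps_frac f g = f * r"
proof -
  have "fps_frac f g = fps_frac f g * g * r" using assms(2) by (simp add: mult.assoc)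
  then show ?thesis using fps_frac_mult[OF assms(1)] by simp
qed

abbreviation color_q_inverse :: "nat \<Rightarrow> color_poly fps" where
  "color_q_inverse k \<equiv> fps_right_inverse (1 - color_q False k) 1"

lemma cq_plain_eq: "cq_plain u (Suc n) i = color_q False (psum u n + i)"
  and cq_over_eq: "cq_over u (Suc n) i = color_q True (psum u n + i)"
  by (simp_all add: cq_plain_def cq_over_def color_q_def mk_part_def Let_def)

lemma fps_frac_cq_plain:
  "fps_frac f (\<Prod>i=1..m. 1 - cq_plain u (Suc n) i) = f * (\<Prod>i=1..m. color_q_inverse (psum u n + i))"
proof (rule fps_frac_eqI)
  show "fps_nth (\<Prod>i=1..m. 1 - cq_plain u (Suc n) i) 0 = 1"
    by (induction m) (simp_all add: cq_plain_eq color_q_def)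
  show "(\<Prod>i=1..m. 1 - cq_plain u (Suc n) i) * (\<Prod>i=1..m. color_q_inverse (psum u n + i)) = 1"
    unfolding prod.distrib[symmetric] by (rule prod.neutral) (simp add: cq_plain_eq color_q_geometric)
qed

lemma Euler_sum_cq:
  fixes u n
  defines "U \<equiv> psum u n"
  shows "(\<Sum>\<sigma> | \<sigma> permutes {1..u (Suc n)}. \<Prod>i=1..u (Suc n) - 1.
        (color_q False (U + i) ^ of_bool (\<sigma> i > \<sigma> (i + 1)) + of_bool ov * color_q True (U + i)))
      * (\<Prod>i=1..u (Suc n) - 1. color_q_inverse (U + i)) = block_asc_sum u ov n"
  unfolding level_weight_def block_Suc U_def
  by (rule Euler_sum_eq_asc_sum) (simp add: color_q_geometric)

lemma one_plus_level_weight: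
  assumes "k \<ge> 1"
  shows "(1 + of_bool ov * color_q True k) * color_q_inverse k = 1 + level_weight ov k"
proof -
  have "(1 + of_bool ov * color_q True k) * color_q_inverse k
      = (1 - color_q False k) * color_q_inverse k + level_weight ov k"
    unfolding level_weight_def by (simp add: algebra_simps)
  then show ?thesis using color_q_geometric[OF assms] by simp
qed

theorem theorem1p23:
  fixes u :: "nat \<Rightarrow> nat"
  assumes "\<forall>n\<ge>1. u n > 0"
  shows
    "convergent_prod (\<lambda>n. fps_frac
        (Euler_bar (u (n+1)) (cq_over u (n+1)) ((cq_plain u (n+1))(u (n+1) := 1)))
        (\<Prod>i=1..u (n+1). 1 - cq_plain u (n+1) i))
     \<and> (gf_term has_sum
         (prodinf (\<lambda>n. fps_frac
            (Euler_bar (u (n+1)) (cq_over u (n+1)) ((cq_plain u (n+1))(u (n+1) := 1)))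
            (\<Prod>i=1..u (n+1). 1 - cq_plain u (n+1) i))))
        (block_overpartitions u)
     \<and> convergent_prod (\<lambda>n. fps_frac
        (Euler (u (n+1)) (cq_plain u (n+1)))
        (\<Prod>i=1..u (n+1). 1 - cq_plain u (n+1) i))
     \<and> (gf_term has_sum
         (prodinf (\<lambda>n. fps_frac
            (Euler (u (n+1)) (cq_plain u (n+1)))
            (\<Prod>i=1..u (n+1). 1 - cq_plain u (n+1) i))))
        (block_partitions u)
     \<and> summable (\<lambda>n. fps_frac
          (Euler_bar (u (n+1)) ((cq_over u (n+1))(u (n+1) := 0))
             ((cq_plain u (n+1))(u (n+1) := 1)))
          (\<Prod>i=1..u (n+1) - 1. 1 - cq_plain u (n+1) i)
        * (\<Prod>m=1..n. fps_frac
             (Euler_bar (u m) (cq_over u m) (cq_plain u m))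
             (\<Prod>i=1..u m. 1 - cq_plain u m i)))
     \<and> (gf_term has_sum
         (suminf (\<lambda>n. fps_frac
            (Euler_bar (u (n+1)) ((cq_over u (n+1))(u (n+1) := 0))
               ((cq_plain u (n+1))(u (n+1) := 1)))
            (\<Prod>i=1..u (n+1) - 1. 1 - cq_plain u (n+1) i)
          * (\<Prod>m=1..n. fps_frac
               (Euler_bar (u m) (cq_over u m) (cq_plain u m))
               (\<Prod>i=1..u m. 1 - cq_plain u m i)))))
        (block_overpartitions_distinct u)"
proof -
  have pos: "u (Suc n) > 0" for n using assms by simp
  have top: "psum u n + u (Suc n) \<ge> 1" for n using pos[of n] by simp
  let ?E = "\<lambda>n ov. \<Sum>\<sigma> | \<sigma> permutes {1..u (Suc n)}. \<Prod>i=1..u (Suc n) - 1.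
    (color_q False (psum u n + i) ^ of_bool (\<sigma> i > \<sigma> (i + 1)) + of_bool ov * color_q True (psum u n + i))"
  have split_top: "(\<Prod>i=1..u (Suc n). color_q_inverse (psum u n + i))
      = (\<Prod>i=1..u (Suc n) - 1. color_q_inverse (psum u n + i)) * color_q_inverse (psum u (Suc n))" for n
    using pos[of n] by (cases "u (Suc n)") auto
  have Euler_bar_cq: "Euler_bar (u (Suc n)) (cq_over u (Suc n)) ((cq_plain u (Suc n))(u (Suc n) := y))
      = (y + color_q True (psum u (Suc n))) * ?E n True" for n y
    unfolding Euler_bar_def by (auto simp: cq_plain_eq cq_over_eq intro!: sum.cong prod.cong)
  have Euler_bar_cq0: "Euler_bar (u (Suc n)) ((cq_over u (Suc n))(u (Suc n) := 0)) ((cq_plain u (Suc n))(u (Suc n) := 1))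
      = ?E n True" for n
    unfolding Euler_bar_def by (auto simp: cq_plain_eq cq_over_eq intro!: sum.cong prod.cong)
  have Euler_cq: "Euler (u (Suc n)) (cq_plain u (Suc n)) = ?E n False" for n
    unfolding Euler_def by (simp add: cq_plain_eq)

  have over: "fps_frac (Euler_bar (u (Suc n)) (cq_over u (Suc n)) ((cq_plain u (Suc n))(u (Suc n) := 1)))
        (\<Prod>i=1..u (Suc n). 1 - cq_plain u (Suc n) i)
      = (1 + level_weight True (psum u (Suc n))) * block_asc_sum u True n" for n
  proof -
    have "(1 + color_q True (psum u (Suc n))) * ?E n True
        * ((\<Prod>i=1..u (Suc n) - 1. color_q_inverse (psum u n + i)) * color_q_inverse (psum u (Suc n)))
      = ((1 + of_bool True * color_q True (psum u (Suc n))) * color_q_inverse (psum u (Suc n)))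
        * (?E n True * (\<Prod>i=1..u (Suc n) - 1. color_q_inverse (psum u n + i)))"
      by (simp only: of_bool_eq mult_1_left mult_ac)
    then show ?thesis
      using top[of n] by (simp only: fps_frac_cq_plain split_top Euler_bar_cq
        Euler_sum_cq one_plus_level_weight psum_Suc)
  qed
  have plain: "fps_frac (Euler (u (Suc n)) (cq_plain u (Suc n))) (\<Prod>i=1..u (Suc n). 1 - cq_plain u (Suc n) i)
      = (1 + level_weight False (psum u (Suc n))) * block_asc_sum u False n" for n
  proof -
    have "?E n False
        * ((\<Prod>i=1..u (Suc n) - 1. color_q_inverse (psum u n + i)) * color_q_inverse (psum u (Suc n)))
      = ((1 + of_bool False * color_q True (psum u (Suc n))) * color_q_inverse (psum u (Suc n)))
        * (?E n False * (\<Prod>i=1..u (Suc n) - 1. color_q_inverse (psum u n + i)))"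
      by (simp only: of_bool_eq mult_zero_left add_0_right mult_1_left mult_ac)
    then show ?thesis
      using top[of n] by (simp only: fps_frac_cq_plain split_top Euler_cq
        Euler_sum_cq one_plus_level_weight psum_Suc)
  qed
  have strict: "fps_frac (Euler_bar (u (Suc n)) (cq_over u (Suc n)) (cq_plain u (Suc n)))
        (\<Prod>i=1..u (Suc n). 1 - cq_plain u (Suc n) i)
      = level_weight True (psum u (Suc n)) * block_asc_sum u True n" for n
  proof -
    have "Euler_bar (u (Suc n)) (cq_over u (Suc n)) (cq_plain u (Suc n))
        = (color_q False (psum u (Suc n)) + color_q True (psum u (Suc n))) * ?E n True"
      using Euler_bar_cq[of n "cq_plain u (Suc n) (u (Suc n))"]
      unfolding fun_upd_triv by (simp only: cq_plain_eq psum_Suc)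
    moreover have "(color_q False (psum u (Suc n)) + color_q True (psum u (Suc n))) * ?E n True
        * ((\<Prod>i=1..u (Suc n) - 1. color_q_inverse (psum u n + i)) * color_q_inverse (psum u (Suc n)))
      = level_weight True (psum u (Suc n))
        * (?E n True * (\<Prod>i=1..u (Suc n) - 1. color_q_inverse (psum u n + i)))"
      unfolding level_weight_def by (simp only: of_bool_eq mult_1_left mult_ac)
    ultimately show ?thesis
      by (simp only: fps_frac_cq_plain split_top Euler_sum_cq)
  qed
  have open_top: "fps_frac (Euler_bar (u (Suc n)) ((cq_over u (Suc n))(u (Suc n) := 0)) ((cq_plain u (Suc n))(u (Suc n) := 1)))
        (\<Prod>i=1..u (Suc n) - 1. 1 - cq_plain u (Suc n) i) = block_asc_sum u True n" for n
    unfolding fps_frac_cq_plain Euler_bar_cq0 by (rule Euler_sum_cq)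

  have prod_lax: "(\<Prod>i\<le>n. (1 + level_weight ov (psum u (Suc i))) * block_asc_sum u ov i)
      = cut_gf u ov False (Suc n)" for n ov
  proof (induction n)
    case 0
    then show ?case by (simp only: cut_gf_Suc_lax[OF assms]) (simp add: cut_gf_0[OF assms])
  next
    case (Suc n)
    then show ?case by (simp only: prod.atMost_Suc cut_gf_Suc_lax[OF assms, of _ "Suc n"])
  qed
  have "(\<lambda>n. \<Prod>i\<le>n. (1 + level_weight ov (psum u (Suc i))) * block_asc_sum u ov i)
      \<longlonglongrightarrow> total_gf u ov False" for ov
    unfolding prod_lax by (rule cut_gf_tendsto[OF assms])
  note lax = prodinf_eq_limit[OF this total_gf_lax_nonzero[OF assms]]

  have prod_strict: "(\<Prod>m=1..n. fps_frac (Euler_bar (u m) (cq_over u m) (cq_plain u m))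
        (\<Prod>i=1..u m. 1 - cq_plain u m i)) = cut_gf u True True n" for n
  proof (induction n)
    case 0
    then show ?case by (simp add: cut_gf_0[OF assms])
  next
    case (Suc n)
    then show ?case
      by (simp only: cut_gf_Suc_strict[OF assms] strict prod.cl_ivl_Suc) simp
  qed
  have "(\<Sum>i<n. block_asc_sum u True i * cut_gf u True True i) = prefix_sum u True True n" for n
  proof (induction n)
    case (Suc n)
    then show ?case by (simp only: sum.lessThan_Suc prefix_sum_Suc[OF assms])
  qed simp
  then have sums: "(\<lambda>n. block_asc_sum u True n * cut_gf u True True n) sums total_gf u True True"
    unfolding sums_def using prefix_sum_tendsto[OF assms, of True True] by simp

  show ?thesis
    unfolding Suc_eq_plus1[symmetric] over plain open_top prod_strict lax(2) sums_unique[OF sums, symmetric]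
      block_overpartitions_eq[OF assms] block_partitions_eq[OF assms]
      block_overpartitions_distinct_eq[OF assms]
    using lax(1) sums_summable[OF sums] gf_term_has_sum_total_gf[OF assms] by blast
qed

end
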